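(* Let $f$ be $\sigma$-strongly convex with a gradient $\nabla f$ that is $L$-Lipschitz, with block Lipschitz constants $\{L_i\}_{i=1}^n$. Let $\psi=9\,S^{-1/2}\underline{L}^{-1/2}L^{3/4}\kappa^{1/4}\,\tau$ satisfy $\psi\le \frac37$ (i.e. $\tau\le\frac1{21}S^{1/2}\underline{L}^{1/2}L^{-3/4}\kappa^{-1/4}$). Then the iterates of the A2BCD algorithm (defined in the context) satisfy, for every $k\ge 0$, $$\mathbb{E}_k\left[\|v_{k+1}\|^2+A_{k+1}+c f(x_{k+1})\right]\le\left(1-(1-\psi)\sigma^{1/2}S^{-1}\right)\left(\|v_k\|^2+A_k+c f(x_k)\right).$$ Moreover, as $\sigma^{-1/2}S\to\infty$, the error $\|v_k\|^2+A_k+cf(x_k)$ has the corresponding iteration complexity $$K_{\mathrm{A2BCD}}(\epsilon)=\left(\sum_{i=1}^n\sqrt{L_i/\sigma}+\mathcal{O}(1)\right)\frac{\ln(1/\epsilon)}{1-\psi}.$$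
   Context: Problem: minimize $f:\mathbb{R}^d\to\mathbb{R}$, where $x=(x_{(1)},\dots,x_{(n)})$ is split into $n$ coordinate blocks and $\nabla f=(\nabla_1 f,\dots,\nabla_n f)$ correspondingly. $f$ is $\sigma$-strongly convex ($\sigma>0$), $\nabla f$ is $L$-Lipschitz, and $\|\nabla_i f(x+P_ih)-\nabla_i f(x)\|\le L_i\|h\|$ for all $x,h\in\mathbb{R}^d$ and all $i$, where $P_i$ is the projection onto block $i$. Notation: $\kappa=L/\sigma$, $\underline{L}=\min_i L_i$, $S=\sum_{i=1}^n L_i^{1/2}$. The minimizer $x_*$ and minimum value are normalized to $x_*=0$, $f(x_* )=0$. Delays: an integer $\tau\ge0$ is given, with delays $j(k,i)\in\{0,\dots,\tau\}$ for iteration $k$ and block $i$. The delayed iterate $\hat y_k$ is the vector whose $i$-th block is the $i$-th block of $y_{k-j(k,i)}$, with $y_k=y_0$ for $k<0$. The delays are independent of the random block sequence $(i_k)$ but otherwise arbitrary. A2BCD: the indices $i_k$ are IID with $\mathbb{P}[i_k=j]=L_j^{1/2}/S$. With $\psi$ as in the claim, put $\alpha=(1+(1+\psi)\sigma^{-1/2}S)^{-1}$, $\beta=1-(1-\psi)\sigma^{1/2}S^{-1}$, $h=1-\frac12\sigma^{1/2}\underline{L}^{-1/2}\psi$. From starting points $x_0,v_0$, iterate (block gradients $\nabla_i f$ being regarded as vectors in $\mathbb{R}^d$ supported on block $i$) $$y_k=\alpha v_k+(1-\alpha)x_k,\quad x_{k+1}=y_k-hL_{i_k}^{-1}\nabla_{i_k}f(\hat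 y_k),\quad v_{k+1}=\beta v_k+(1-\beta)y_k-\sigma^{-1/2}L_{i_k}^{-1/2}\nabla_{i_k}f(\hat y_k).$$ Asynchronicity error: $A_k=\sum_{j=1}^{\tau}c_j\|y_{k+1-j}-y_{k-j}\|^2$, where $c_i=\frac6S L^{1/2}\kappa^{3/2}\tau\,\psi^{-1}\sum_{j=i}^{\tau}(1-\sigma^{1/2}S^{-1})^{i-j-1}$ (and $A_k\equiv0$ if $\tau=0$). Also $c=2\sigma^{-1/2}S^{-1}(\beta\alpha^{-1}(1-\alpha)+1)$. $\mathbb{E}_k$ is expectation conditional on $x_0,\dots,x_k$, $y_0,\dots,y_k$, $v_0,\dots,v_k$, $i_0,\dots,i_{k-1}$. Iteration complexity with respect to an error $E^k$: the number $K$ of iterations after which the expected error $\mathbb{E}[E^K]$ has decreased to at most $\epsilon E^0$, as guaranteed by the linear rate; for a linear rate $\mathbb{E}_k[E^{k+1}]\le(1-\rho)E^k$ this is $K(\epsilon)=\ln(1/\epsilon)/(-\ln(1-\rho))$. $\mathcal{O}(1)$ denotes a quantity bounded as $\sigma^{-1/2}S\to\infty$.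
   Formalization: The formal theorem additionally assumes min_i L_i ≤ L, which is automatic when the L_i are the least block Lipschitz constants; for arbitrary oversized L_i with positive delay the claim can fail (n=1, f=x²/2, L_1 huge). *)

theory Defs
  imports "HOL-Probability.Probability" "HOL-Library.Landau_Symbols"
begin

section \<open>Problem parameters\<close>

text \<open>The parameters are kept apart from the objective function and from the dimension, so that
  asymptotic statements can be uniform over all of them, including the number of blocks.
  Blocks are numbered \<open>0, \<dots>, num_blocks p - 1\<close>.\<close>

record a2bcd_params =
  num_blocks :: nat                    \<comment> \<open>\<open>n\<close>\<close>
  blk_lip :: "nat \<Rightarrow> real"             \<comment> \<open>\<open>L\<^sub>i\<close>\<close>
  grad_lip :: real                     \<comment> \<open>\<open>L\<close>\<close>
  str_cvx :: real                      \<comment> \<open>\<open>\<sigma>\<close>\<close>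
  max_delay :: nat                     \<comment> \<open>\<open>\<tau>\<close>\<close>

definition kappa :: "a2bcd_params \<Rightarrow> real" where
  "kappa p = grad_lip p / str_cvx p"

definition min_lip :: "a2bcd_params \<Rightarrow> real" where
  "min_lip p = Min (blk_lip p ` {..<num_blocks p})"

definition S_sum :: "a2bcd_params \<Rightarrow> real" where
  "S_sum p = (\<Sum>i<num_blocks p. sqrt (blk_lip p i))"

definition psi :: "a2bcd_params \<Rightarrow> real" where
  "psi p = 9 * S_sum p powr (-1/2) * min_lip p powr (-1/2) * grad_lip p powr (3/4)
             * kappa p powr (1/4) * real (max_delay p)"

definition alpha :: "a2bcd_params \<Rightarrow> real" where
  "alpha p = inverse (1 + (1 + psi p) * S_sum p / sqrt (str_cvx p))"

definition beta :: "a2bcd_params \<Rightarrow> real" where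
  "beta p = 1 - (1 - psi p) * sqrt (str_cvx p) / S_sum p"

definition step_h :: "a2bcd_params \<Rightarrow> real" where
  "step_h p = 1 - 1/2 * sqrt (str_cvx p) / sqrt (min_lip p) * psi p"

definition c_fun :: "a2bcd_params \<Rightarrow> real" where
  "c_fun p = 2 / (sqrt (str_cvx p) * S_sum p) * (beta p * (1 - alpha p) / alpha p + 1)"

definition c_async :: "a2bcd_params \<Rightarrow> nat \<Rightarrow> real" where
  "c_async p i = 6 / S_sum p * sqrt (grad_lip p) * kappa p powr (3/2) * real (max_delay p) / psi p
     * (\<Sum>j=i..max_delay p. (1 - sqrt (str_cvx p) / S_sum p) powi (int i - int j - 1))"


section \<open>Objective functions\<close>

definition strongly_convex :: "real \<Rightarrow> ('a::real_inner \<Rightarrow> real) \<Rightarrow> bool" where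
  "strongly_convex \<sigma> f \<longleftrightarrow>
     (\<forall>x y. \<forall>t\<in>{0..1}. f ((1 - t) *\<^sub>R x + t *\<^sub>R y)
        \<le> (1 - t) * f x + t * f y - \<sigma> / 2 * t * (1 - t) * (norm (x - y))\<^sup>2)"

text \<open>A splitting of the coordinates \<open>'d\<close> into blocks is given by the map \<open>blk\<close> that sends a
  coordinate to the number of its block. A block of a vector is regarded as a vector of the full
  space supported on that block.\<close>

definition blk_proj :: "('d \<Rightarrow> nat) \<Rightarrow> nat \<Rightarrow> real ^ 'd \<Rightarrow> real ^ 'd" where
  "blk_proj blk i x = (\<chi> a. if blk a = i then x $ a else 0)"


section \<open>Asynchronous iterates\<close>

text \<open>Truncated subtraction on the natural numbers implements the convention that
  \<open>y\<^sub>k = y\<^sub>0\<close> for negative \<open>k\<close>, here and in the asynchronicity error.\<close>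

definition delayed :: "('d \<Rightarrow> nat) \<Rightarrow> (nat \<Rightarrow> nat \<Rightarrow> nat) \<Rightarrow> (nat \<Rightarrow> real ^ 'd) \<Rightarrow> nat \<Rightarrow> real ^ 'd" where
  "delayed blk d y k = (\<chi> a. y (k - d k (blk a)) $ a)"

definition async_err :: "a2bcd_params \<Rightarrow> (nat \<Rightarrow> 'a::real_normed_vector) \<Rightarrow> nat \<Rightarrow> real" where
  "async_err p y k =
     (\<Sum>j=1..max_delay p. c_async p j * (norm (y (k + 1 - j) - y (k - j)))\<^sup>2)"

definition a2bcd_error ::
  "a2bcd_params \<Rightarrow> (real ^ 'd \<Rightarrow> real) \<Rightarrow> (nat \<Rightarrow> 'w \<Rightarrow> real ^ 'd) \<Rightarrow> (nat \<Rightarrow> 'w \<Rightarrow> real ^ 'd)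
     \<Rightarrow> (nat \<Rightarrow> 'w \<Rightarrow> real ^ 'd) \<Rightarrow> nat \<Rightarrow> 'w \<Rightarrow> real" where
  "a2bcd_error p f x y v k \<omega> =
     (norm (v k \<omega>))\<^sup>2 + async_err p (\<lambda>m. y m \<omega>) k + c_fun p * f (x k \<omega>)"

text \<open>The \<open>\<sigma>\<close>-algebra generated by \<open>x\<^sub>0, \<dots>, x\<^sub>k\<close>, \<open>y\<^sub>0, \<dots>, y\<^sub>k\<close>, \<open>v\<^sub>0, \<dots>, v\<^sub>k\<close> and the
  block indices of the iterations strictly before \<open>k\<close>.\<close>

definition history ::
  "'w measure \<Rightarrow> (nat \<Rightarrow> 'w \<Rightarrow> real ^ 'd) \<Rightarrow> (nat \<Rightarrow> 'w \<Rightarrow> real ^ 'd) \<Rightarrow> (nat \<Rightarrow> 'w \<Rightarrow> real ^ 'd)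
     \<Rightarrow> (nat \<Rightarrow> 'w \<Rightarrow> nat) \<Rightarrow> nat \<Rightarrow> 'w measure" where
  "history M x y v I k = sigma (space M)
     ({u m -` B \<inter> space M | u m B. u \<in> {x, y, v} \<and> m \<le> k \<and> B \<in> sets borel}
      \<union> {I m -` B \<inter> space M | m B. m < k})"


section \<open>Iteration complexity\<close>

text \<open>The real solution \<open>K\<close> of \<open>(1 - \<rho>)\<^sup>K = \<epsilon>\<close>.\<close>

definition iteration_complexity :: "real \<Rightarrow> real \<Rightarrow> real" where
  "iteration_complexity \<rho> \<epsilon> = ln (1 / \<epsilon>) / (- ln (1 - \<rho>))"

definition K_A2BCD :: "a2bcd_params \<Rightarrow> real \<Rightarrow> real" where
  "K_A2BCD p = iteration_complexity ((1 - psi p) * sqrt (str_cvx p) / S_sum p)"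

text \<open>Positivity of all constants is automatic for parameters that come from a strongly convex
  function with nonempty blocks.\<close>

definition admissible_params :: "a2bcd_params set" where
  "admissible_params = {q. 0 < num_blocks q \<and> 0 < str_cvx q \<and> 0 < grad_lip q
     \<and> (\<forall>i<num_blocks q. 0 < blk_lip q i) \<and> psi q \<le> 3/7}"

text \<open>The limit \<open>\<sigma>\<^sup>-\<^sup>1\<^sup>/\<^sup>2 S \<rightarrow> \<infinity>\<close>, with all parameters allowed to vary.\<close>

definition cond_at_top :: "a2bcd_params filter" where
  "cond_at_top = inf (filtercomap (\<lambda>q. S_sum q / sqrt (str_cvx q)) at_top)
                     (principal admissible_params)"

end

theory Submission
  imports Defs
begin

text \<open>Put \<open>s = \<sigma>\<^sup>1\<^sup>/\<^sup>2 / S\<close>, so that \<open>\<beta> = 1 - \<rho>\<close> with \<open>\<rho> = (1 - \<psi>) s\<close>, and let \<open>g\<close> denote the gradient at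
  the delayed iterate in iteration \<open>k\<close>. This \<open>g\<close> is a function of the earlier block indices and
  of the delays, and the block index \<open>i\<^sub>k\<close> is independent of both. Consider the average, over the
  blocks \<open>i\<close> with weights \<open>L\<^sub>i\<^sup>1\<^sup>/\<^sup>2 / S\<close>, of the error that results from updating block \<open>i\<close>: a bound
  for this average by a function of the history is a bound for the conditional expectation of the
  next error (\<open>real_cond_exp_indep_choice_le\<close>). What has to be proved is the deterministic inequality
  \<open>one_step_error_mean\<close> between this average and \<open>\<beta>\<close> times the present error.

  Without delays, \<open>g = \<nabla>f(y)\<close>. The square \<open>\<parallel>v\<^sub>k\<^sub>+\<^sub>1\<parallel>\<^sup>2\<close> then contributes the scalar product of
  \<open>-g\<close> with \<open>w = \<beta> v + (1 - \<beta>) y = y + \<beta> (v - y)\<close>, where \<open>v - y\<close> is a positive multiple of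
  \<open>y - x\<close>. Strong convexity between \<open>y\<close> and the minimizer \<open>0\<close>, and convexity between \<open>y\<close> and
  \<open>x\<close>, turn this product into a multiple of \<open>f(x)\<close> minus a multiple of \<open>f(y)\<close>. The choice of \<open>c\<close>
  makes the latter cancel the term \<open>c f(y)\<close> of the descent inequality for \<open>x\<^sub>k\<^sub>+\<^sub>1\<close>, and the
  decrease of \<open>c f\<close> in that inequality pays for the squares of the block gradients in
  \<open>\<parallel>v\<^sub>k\<^sub>+\<^sub>1\<parallel>\<^sup>2\<close>.

  With delays, each of these steps leaves a term that is linear in \<open>e = \<nabla>f(y) - g\<close>. The parameters
  are chosen with some slack of order \<open>\<psi>\<close>: \<open>\<rho>\<close> is smaller than \<open>s\<close>, which frees
  \<open>\<psi> s \<parallel>y\<parallel>\<^sup>2\<close>; the convexity of the square frees \<open>\<beta> \<rho> \<parallel>v - y\<parallel>\<^sup>2\<close>; and \<open>c\<close> exceeds \<open>2/\<sigma>\<close>, which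
  frees a multiple of the squared block gradients. Young's inequality converts the linear terms into
  these quantities at the price of at most \<open>6 s / (\<sigma>\<^sup>2 \<psi>) \<parallel>e\<parallel>\<^sup>2\<close>, and enough slack remains to pay
  for the new term \<open>c\<^sub>1 \<parallel>y\<^sub>k\<^sub>+\<^sub>1 - y\<^sub>k\<parallel>\<^sup>2\<close> of the asynchronicity error (\<open>one_step_mean\<close>).
  Since \<open>\<nabla>f\<close> is \<open>L\<close>-Lipschitz, \<open>\<parallel>e\<parallel>\<^sup>2\<close> is at most \<open>L\<^sup>2 \<tau>\<close> times the sum of the last \<open>\<tau>\<close> squared
  increments of \<open>y\<close>. The coefficients satisfy \<open>(1 - s) c\<^sub>i - c\<^sub>i\<^sub>+\<^sub>1 = 6 s L\<^sup>2 \<tau> / (\<sigma>\<^sup>2 \<psi>)\<close>, so the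
  contraction of the asynchronicity error absorbs exactly this
  (\<open>async_err_absorbs_staleness\<close>).

  The bound \<open>\<psi> \<le> 3/7\<close> enters through the numerical constants and also makes \<open>s\<close> small: a positive
  delay implies \<open>441 \<tau>\<^sup>2 s \<le> 1\<close> (\<open>inv_cond_small\<close>). This bounds \<open>c\<^sub>1\<close> and makes the motion of \<open>y\<close> due
  to \<open>v - y\<close> negligible.

  The complexity formula follows from \<open>\<rho> \<le> - ln (1 - \<rho>) \<le> \<rho> / (1 - \<rho>)\<close>: the quantity
  \<open>1 / (- ln (1 - \<rho>))\<close> differs from \<open>1 / \<rho>\<close> by at most \<open>1\<close>.\<close>


section \<open>Block projections\<close>

lemma blk_proj_inner:
  "blk_proj blk i u \<bullet> w = (\<Sum>a\<in>UNIV. if blk a = i then u $ a * w $ a else 0)"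
  unfolding blk_proj_def inner_vec_def by (intro sum.cong) auto

lemma blk_proj_idem: "blk_proj blk i (blk_proj blk i u) = blk_proj blk i u"
  by (simp add: blk_proj_def vec_eq_iff)

lemma blk_proj_zero [simp]: "blk_proj blk i 0 = 0"
  by (simp add: blk_proj_def vec_eq_iff)

lemma blk_proj_diff: "blk_proj blk i (u - w) = blk_proj blk i u - blk_proj blk i w"
  by (simp add: blk_proj_def vec_eq_iff)

lemma blk_proj_scaleR: "blk_proj blk i (t *\<^sub>R u) = t *\<^sub>R blk_proj blk i u"
  by (simp add: blk_proj_def vec_eq_iff)

lemma blk_proj_self_adjoint: "blk_proj blk i u \<bullet> w = u \<bullet> blk_proj blk i w"
  unfolding blk_proj_def inner_vec_def by (intro sum.cong) auto

lemma blk_proj_inner_blk_proj: "blk_proj blk i u \<bullet> blk_proj blk i w = u \<bullet> blk_proj blk i w"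
  by (metis blk_proj_idem blk_proj_self_adjoint)

lemma norm_blk_proj_sq: "(norm (blk_proj blk i u))\<^sup>2 = u \<bullet> blk_proj blk i u"
  by (simp add: power2_norm_eq_inner blk_proj_inner_blk_proj)

lemma norm_blk_proj_le: "norm (blk_proj blk i u) \<le> norm u"
  by (rule norm_le_componentwise_cart) (simp add: blk_proj_def)

lemma sum_inner_blk_proj:
  fixes blk :: "'d::finite \<Rightarrow> nat"
  assumes "range blk \<subseteq> {..<n}"
  shows "(\<Sum>i<n. w \<bullet> blk_proj blk i u) = w \<bullet> u"
proof -
  have "(\<Sum>i<n. w \<bullet> blk_proj blk i u)
      = (\<Sum>a\<in>UNIV. \<Sum>i<n. if blk a = i then u $ a * w $ a else 0)"
    by (subst sum.swap) (simp add: blk_proj_inner inner_commute[of w])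
  also have "\<dots> = (\<Sum>a\<in>UNIV. u $ a * w $ a)"
    using assms by (intro sum.cong refl) (auto simp: subset_iff)
  also have "\<dots> = w \<bullet> u"
    by (simp add: inner_vec_def mult.commute)
  finally show ?thesis .
qed

lemma sum_norm_blk_proj_sq:
  fixes blk :: "'d::finite \<Rightarrow> nat"
  assumes "range blk \<subseteq> {..<n}"
  shows "(\<Sum>i<n. (norm (blk_proj blk i u))\<^sup>2) = (norm u)\<^sup>2"
  by (simp only: norm_blk_proj_sq sum_inner_blk_proj[OF assms]) (rule power2_norm_eq_inner[symmetric])

lemma blk_proj_measurable [measurable]:
  "blk_proj blk i \<in> borel_measurable (borel :: (real ^ 'd::finite) measure)"
proof -
  have "bounded_linear (blk_proj blk i :: real ^ 'd \<Rightarrow> real ^ 'd)"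
    by (rule linear_conv_bounded_linear[THEN iffD1], rule linearI)
       (simp_all add: blk_proj_def vec_eq_iff)
  then show ?thesis
    by (intro borel_measurable_continuous_onI linear_continuous_on)
qed


section \<open>Strong convexity and block smoothness\<close>

text \<open>Divide the defining inequality by \<open>t\<close> and let \<open>t\<close> tend to \<open>0\<close>: the difference quotient on
  the left tends to the directional derivative.\<close>

lemma strongly_convex_first_order:
  fixes f :: "'a::real_inner \<Rightarrow> real"
  assumes sc: "strongly_convex \<sigma> f" and der: "GDERIV f z :> g"
  shows "f z + g \<bullet> (w - z) + \<sigma> / 2 * (norm (w - z))\<^sup>2 \<le> f w"
proof -
  let ?\<phi> = "\<lambda>t. f (z + t *\<^sub>R (w - z))"
  have "(?\<phi> has_derivative (\<lambda>t. (t *\<^sub>R (w - z)) \<bullet> g)) (at 0)"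
  proof (rule has_derivative_compose[where g=f and f="\<lambda>t. z + t *\<^sub>R (w - z)"])
    show "((\<lambda>t. z + t *\<^sub>R (w - z)) has_derivative (\<lambda>t. t *\<^sub>R (w - z))) (at 0)"
      by (auto intro!: derivative_eq_intros)
    show "(f has_derivative (\<lambda>h. h \<bullet> g)) (at (z + 0 *\<^sub>R (w - z)))"
      using der by (simp add: gderiv_def)
  qed
  then have "(?\<phi> has_real_derivative (w - z) \<bullet> g) (at 0)"
    by (rule has_derivative_imp_has_field_derivative) simp
  then have lim: "((\<lambda>t. (?\<phi> t - ?\<phi> 0) / t) \<longlongrightarrow> (w - z) \<bullet> g) (at_right 0)"
    by (auto simp: has_field_derivative_iff intro: tendsto_mono at_le)
  have lim': "((\<lambda>t. f w - f z - \<sigma> / 2 * (1 - t) * (norm (z - w))\<^sup>2)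
      \<longlongrightarrow> f w - f z - \<sigma> / 2 * (1 - 0) * (norm (z - w))\<^sup>2) (at_right 0)"
    by (intro tendsto_intros)
  have "(w - z) \<bullet> g \<le> f w - f z - \<sigma> / 2 * (1 - 0) * (norm (z - w))\<^sup>2"
  proof (rule tendsto_le[OF _ lim' lim])
    have "(?\<phi> t - ?\<phi> 0) / t \<le> f w - f z - \<sigma> / 2 * (1 - t) * (norm (z - w))\<^sup>2"
      if t: "0 < t" "t < 1" for t
    proof -
      have "f ((1 - t) *\<^sub>R z + t *\<^sub>R w)
          \<le> (1 - t) * f z + t * f w - \<sigma> / 2 * t * (1 - t) * (norm (z - w))\<^sup>2"
        using sc t by (simp add: strongly_convex_def)
      moreover have "(1 - t) *\<^sub>R z + t *\<^sub>R w = z + t *\<^sub>R (w - z)"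
        by (simp add: algebra_simps)
      ultimately have "?\<phi> t - ?\<phi> 0 \<le> t * (f w - f z - \<sigma> / 2 * (1 - t) * (norm (z - w))\<^sup>2)"
        by (simp add: algebra_simps)
      then show ?thesis
        using t by (simp add: pos_divide_le_eq mult.commute)
    qed
    then show "\<forall>\<^sub>F t in at_right 0.
        (?\<phi> t - ?\<phi> 0) / t \<le> f w - f z - \<sigma> / 2 * (1 - t) * (norm (z - w))\<^sup>2"
      using eventually_at_right_less[of "0::real"] eventually_at_right_field[of _ "0::real"]
      by (intro eventually_at_right_field[THEN iffD2] exI[of _ 1]) auto
  qed simp
  then show ?thesis
    by (simp add: inner_commute norm_minus_commute)
qed

text \<open>Compare \<open>f (z + t u)\<close> with the parabola that has the same value and slope at \<open>t = 0\<close>: the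
  parabola minus the function has a nonnegative derivative on \<open>[0, 1]\<close>.\<close>

lemma descent_along_direction:
  fixes f :: "'a::real_inner \<Rightarrow> real"
  assumes der: "\<And>z. GDERIV f z :> grad z"
    and lip: "\<And>t. 0 \<le> t \<Longrightarrow> t \<le> 1 \<Longrightarrow>
      (grad (z + t *\<^sub>R u) - grad z) \<bullet> u \<le> t * (l * (norm u)\<^sup>2)"
  shows "f (z + u) \<le> f z + grad z \<bullet> u + l / 2 * (norm u)\<^sup>2"
proof -
  let ?\<phi> = "\<lambda>t. f z + t * (grad z \<bullet> u) + t\<^sup>2 * (l / 2 * (norm u)\<^sup>2) - f (z + t *\<^sub>R u)"
  have line: "((\<lambda>t. f (z + t *\<^sub>R u)) has_real_derivative u \<bullet> grad (z + t *\<^sub>R u)) (at t)" for t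
  proof -
    have "((\<lambda>t. f (z + t *\<^sub>R u)) has_derivative (\<lambda>h. (h *\<^sub>R u) \<bullet> grad (z + t *\<^sub>R u))) (at t)"
    proof (rule has_derivative_compose[where g=f and f="\<lambda>t. z + t *\<^sub>R u"])
      show "((\<lambda>t. z + t *\<^sub>R u) has_derivative (\<lambda>h. h *\<^sub>R u)) (at t)"
        by (auto intro!: derivative_eq_intros)
      show "(f has_derivative (\<lambda>h. h \<bullet> grad (z + t *\<^sub>R u))) (at (z + t *\<^sub>R u))"
        using der[of "z + t *\<^sub>R u"] by (simp add: gderiv_def)
    qed
    then show ?thesis
      by (rule has_derivative_imp_has_field_derivative) simp
  qed
  have "?\<phi> 0 \<le> ?\<phi> 1"
  proof (rule DERIV_nonneg_imp_nondecreasing[of 0 1 ?\<phi>])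
    fix t :: real assume t: "0 \<le> t" "t \<le> 1"
    let ?d = "grad z \<bullet> u + t * (l * (norm u)\<^sup>2) - u \<bullet> grad (z + t *\<^sub>R u)"
    have "(?\<phi> has_real_derivative ?d) (at t)"
      by (rule derivative_eq_intros line refl | simp)+
    moreover have "0 \<le> ?d"
      using lip[OF t] by (simp add: inner_diff_left inner_commute[of u])
    ultimately show "\<exists>d. (?\<phi> has_real_derivative d) (at t) \<and> 0 \<le> d"
      by blast
  qed simp
  then show ?thesis by simp
qed

lemma inner_young:
  fixes u w :: "'a::real_inner"
  assumes "0 < a"
  shows "2 * (u \<bullet> w) \<le> a * (norm u)\<^sup>2 + (norm w)\<^sup>2 / a"
proof -
  have "0 \<le> (norm (a *\<^sub>R u - w))\<^sup>2 / a" using assms by simp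
  also have "\<dots> = a * (norm u)\<^sup>2 - 2 * (u \<bullet> w) + (norm w)\<^sup>2 / a"
    using assms unfolding power2_norm_eq_inner
    by (simp add: inner_diff_left inner_diff_right inner_commute field_simps)
  finally show ?thesis by simp
qed


section \<open>Parameters and objective\<close>

text \<open>The rate that would be attained without delays; its inverse is the sum of the
  \<open>(L\<^sub>i / \<sigma>)\<^sup>1\<^sup>/\<^sup>2\<close>.\<close>

definition inv_cond :: "a2bcd_params \<Rightarrow> real" where
  "inv_cond p = sqrt (str_cvx p) / S_sum p"

definition blk_prob :: "a2bcd_params \<Rightarrow> nat \<Rightarrow> real" where
  "blk_prob p i = sqrt (blk_lip p i) / S_sum p"

lemma psi_nonneg: "0 \<le> psi p"
  by (simp add: psi_def)

locale a2bcd_objective =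
  fixes p :: a2bcd_params
    and f :: "real ^ 'd \<Rightarrow> real"
    and grad :: "real ^ 'd \<Rightarrow> real ^ 'd"
    and blk :: "'d::finite \<Rightarrow> nat"
  assumes blocks: "range blk = {..<num_blocks p}"
    and sigma_pos: "0 < str_cvx p"
    and strongly_convex: "strongly_convex (str_cvx p) f"
    and gradient: "\<And>z. GDERIV f z :> grad z"
    and gradient_lipschitz: "(grad_lip p)-lipschitz_on UNIV grad"
    and block_lipschitz: "\<And>i z h. i < num_blocks p \<Longrightarrow>
      norm (blk_proj blk i (grad (z + blk_proj blk i h)) - blk_proj blk i (grad z))
        \<le> blk_lip p i * norm h"
    and min_lip_le: "min_lip p \<le> grad_lip p"
    and minimizer: "\<And>z. f 0 \<le> f z" and minimum: "f 0 = 0"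
    and psi_le: "psi p \<le> 3/7"
begin

abbreviation "n \<equiv> num_blocks p"
abbreviation "\<sigma> \<equiv> str_cvx p"
abbreviation "L \<equiv> grad_lip p"
abbreviation "Lmin \<equiv> min_lip p"
abbreviation "S \<equiv> S_sum p"
abbreviation "\<psi> \<equiv> psi p"
abbreviation "\<tau> \<equiv> max_delay p"
abbreviation "s \<equiv> inv_cond p"
abbreviation "q \<equiv> blk_prob p"

lemma f_nonneg: "0 \<le> f z"
  using minimizer[of z] minimum by simp

lemma num_blocks_pos: "0 < n"
proof -
  have "blk undefined \<in> {..<n}" using blocks by blast
  then show ?thesis by auto
qed

lemma convex_lower: "f z + grad z \<bullet> (w - z) + \<sigma> / 2 * (norm (w - z))\<^sup>2 \<le> f w"
  by (rule strongly_convex_first_order[OF strongly_convex gradient])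

lemma block_slope:
  assumes "i < n"
  shows "(grad (z + t *\<^sub>R blk_proj blk i u) - grad z) \<bullet> blk_proj blk i u
    \<le> blk_lip p i * \<bar>t\<bar> * (norm (blk_proj blk i u))\<^sup>2"
proof -
  let ?h = "t *\<^sub>R blk_proj blk i u"
  have h: "blk_proj blk i ?h = ?h" by (simp add: blk_proj_scaleR blk_proj_idem)
  have "(grad (z + ?h) - grad z) \<bullet> blk_proj blk i u
      = blk_proj blk i (grad (z + blk_proj blk i ?h) - grad z) \<bullet> blk_proj blk i u"
    by (simp only: blk_proj_inner_blk_proj h)
  also have "\<dots> \<le> norm (blk_proj blk i (grad (z + blk_proj blk i ?h)) - blk_proj blk i (grad z))
      * norm (blk_proj blk i u)"
    unfolding blk_proj_diff by (rule norm_cauchy_schwarz)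
  also have "\<dots> \<le> (blk_lip p i * norm ?h) * norm (blk_proj blk i u)"
    by (intro mult_right_mono block_lipschitz[OF assms]) simp
  finally show ?thesis by (simp add: power2_eq_square mult_ac)
qed

lemma block_descent:
  assumes "i < n"
  shows "f (z + blk_proj blk i u)
    \<le> f z + grad z \<bullet> blk_proj blk i u + blk_lip p i / 2 * (norm (blk_proj blk i u))\<^sup>2"
proof (rule descent_along_direction[OF gradient])
  fix t :: real assume "0 \<le> t" "t \<le> 1"
  then show "(grad (z + t *\<^sub>R blk_proj blk i u) - grad z) \<bullet> blk_proj blk i u
      \<le> t * (blk_lip p i * (norm (blk_proj blk i u))\<^sup>2)"
    using block_slope[OF assms, of z t u] by (simp add: mult_ac)
qed

text \<open>Along a coordinate direction of block \<open>i\<close> the slope grows at least at rate \<open>\<sigma>\<close>, by strong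
  convexity, and at most at rate \<open>L\<^sub>i\<close>. This is where nonemptiness of the blocks enters.\<close>

lemma sigma_le_blk_lip:
  assumes "i < n"
  shows "\<sigma> \<le> blk_lip p i"
proof -
  obtain a where a: "blk a = i" using assms blocks by (metis imageE lessThan_iff)
  define u :: "real ^ 'd" where "u = axis a 1"
  have u: "blk_proj blk i u = u"
    using a by (auto simp: blk_proj_def u_def axis_def vec_eq_iff)
  have nu: "norm u = 1" by (simp add: u_def)
  have "f u + grad u \<bullet> (0 - u) + \<sigma> / 2 * (norm (0 - u))\<^sup>2 \<le> f 0"
    "f 0 + grad 0 \<bullet> (u - 0) + \<sigma> / 2 * (norm (u - 0))\<^sup>2 \<le> f u"
    by (rule convex_lower)+
  then have "\<sigma> \<le> (grad u - grad 0) \<bullet> u"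
    by (simp add: nu inner_diff_left)
  also have "\<dots> \<le> blk_lip p i"
    using block_slope[OF assms, of 0 1 u] by (simp add: u nu)
  finally show ?thesis .
qed

lemma blk_lip_pos: "i < n \<Longrightarrow> 0 < blk_lip p i"
  using sigma_le_blk_lip[of i] sigma_pos by linarith

lemma min_lip_le_blk: "i < n \<Longrightarrow> Lmin \<le> blk_lip p i"
  unfolding min_lip_def by (rule Min_le) auto

lemma sigma_le_min_lip: "\<sigma> \<le> Lmin"
  unfolding min_lip_def using num_blocks_pos sigma_le_blk_lip by (subst Min_ge_iff) auto

lemma min_lip_pos: "0 < Lmin"
  using sigma_le_min_lip sigma_pos by linarith

lemma grad_lip_pos: "0 < L"
  using min_lip_pos min_lip_le by linarith

lemma sqrt_sigma_le_S: "sqrt \<sigma> \<le> S"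
proof -
  have "sqrt \<sigma> \<le> sqrt (blk_lip p 0)"
    using sigma_le_blk_lip[OF num_blocks_pos] by simp
  also have "\<dots> \<le> (\<Sum>i<n. sqrt (blk_lip p i))"
    using num_blocks_pos
    by (intro member_le_sum) (auto intro: less_imp_le blk_lip_pos)
  finally show ?thesis unfolding S_sum_def .
qed

lemma S_pos: "0 < S"
  using sqrt_sigma_le_S sigma_pos by (meson less_le_trans real_sqrt_gt_zero)

lemma inv_cond_pos: "0 < s"
  using S_pos sigma_pos by (simp add: inv_cond_def)

lemma inv_cond_le_1: "s \<le> 1"
  using S_pos sqrt_sigma_le_S by (simp add: inv_cond_def)

lemma blk_prob_nonneg: "i < n \<Longrightarrow> 0 \<le> q i"
  using S_pos blk_lip_pos[of i] by (simp add: blk_prob_def)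

lemma sum_blk_prob: "(\<Sum>i<n. q i) = 1"
  using S_pos unfolding blk_prob_def by (simp add: sum_divide_distrib[symmetric] S_sum_def[symmetric])

lemma beta_eq: "beta p = 1 - (1 - \<psi>) * s"
  by (simp add: beta_def inv_cond_def)

lemma alpha_eq: "alpha p = s / (s + (1 + \<psi>))"
  using sigma_pos S_pos psi_nonneg[of p]
  by (simp add: alpha_def inv_cond_def field_simps)

lemma alpha_bounds: "0 < alpha p" "alpha p \<le> s" "alpha p < 1"
proof -
  have "0 < s + (1 + \<psi>)" "1 \<le> s + (1 + \<psi>)" using inv_cond_pos psi_nonneg[of p] by linarith+
  then show "0 < alpha p" "alpha p \<le> s" "alpha p < 1"
    using inv_cond_pos psi_nonneg[of p] unfolding alpha_eq
    by (simp_all add: divide_le_eq mult_le_cancel_left1)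
qed

lemma beta_bounds: "0 \<le> beta p" "beta p \<le> 1"
proof -
  have "0 \<le> (1 - \<psi>) * s" using psi_le inv_cond_pos by simp
  moreover have "(1 - \<psi>) * s \<le> 1 * 1"
    using inv_cond_pos inv_cond_le_1 psi_nonneg[of p] psi_le by (intro mult_mono) auto
  ultimately show "0 \<le> beta p" "beta p \<le> 1" unfolding beta_eq by auto
qed

text \<open>In this form it is visible that \<open>c\<close> is \<open>2 / \<sigma>\<close> up to a relative excess of order \<open>\<psi>\<close>.\<close>

lemma c_fun_eq: "c_fun p = 2 / \<sigma> * (1 + \<psi> + \<psi>\<^sup>2 * s)"
proof -
  have "(1 - alpha p) / alpha p = (1 + \<psi>) / s"
  proof -
    have D: "0 < s + (1 + \<psi>)" using inv_cond_pos psi_nonneg[of p] by linarith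
    then have "1 - alpha p = (1 + \<psi>) / (s + (1 + \<psi>))"
      unfolding alpha_eq by (simp add: field_simps)
    then show ?thesis using D by (simp add: alpha_eq)
  qed
  moreover have "sqrt \<sigma> * S = \<sigma> / s"
    using sigma_pos S_pos by (simp add: inv_cond_def field_simps)
  moreover have "c_fun p = 2 / (sqrt \<sigma> * S) * (beta p * ((1 - alpha p) / alpha p) + 1)"
    by (simp add: c_fun_def)
  ultimately have "c_fun p = 2 / (\<sigma> / s) * (beta p * ((1 + \<psi>) / s) + 1)"
    by (simp only:)
  then have "s * c_fun p = s * (2 / \<sigma> * (1 + \<psi> + \<psi>\<^sup>2 * s))"
    using inv_cond_pos sigma_pos by (simp add: beta_eq field_simps power2_eq_square)
  then show ?thesis
    using inv_cond_pos by (metis mult_left_cancel less_irrefl)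
qed

lemma c_fun_nonneg: "0 \<le> c_fun p"
  using sigma_pos psi_nonneg[of p] inv_cond_pos by (simp add: c_fun_eq)

lemma psi_eq_0_iff: "\<psi> = 0 \<longleftrightarrow> \<tau> = 0"
proof -
  have "kappa p > 0" using grad_lip_pos sigma_pos by (simp add: kappa_def)
  then show ?thesis using S_pos min_lip_pos grad_lip_pos by (simp add: psi_def)
qed

text \<open>Squaring \<open>\<psi>\<close> removes its fractional powers. The product \<open>L\<^sup>2 \<tau>\<^sup>2\<close> on the right is the one that
  governs the size of \<open>c\<^sub>1\<close>.\<close>

lemma psi_sq: "\<psi>\<^sup>2 * (S * Lmin * sqrt \<sigma>) = 81 * L\<^sup>2 * (real \<tau>)\<^sup>2"
proof -
  have sq: "(x powr a)\<^sup>2 = x powr (2 * a)" if "0 < x" for x a :: real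
    using that by (simp add: powr_mult_base powr_add[symmetric] power2_eq_square)
  have kap: "kappa p > 0" using grad_lip_pos sigma_pos by (simp add: kappa_def)
  have L32: "L powr (3/2) = L * sqrt L"
    using grad_lip_pos powr_add[of L 1 "1/2"] by (simp add: powr_half_sqrt)
  have "\<psi>\<^sup>2 = 81 * S powr -1 * Lmin powr -1 * L powr (3/2) * kappa p powr (1/2) * (real \<tau>)\<^sup>2"
    using S_pos min_lip_pos grad_lip_pos kap by (simp add: psi_def power_mult_distrib sq)
  also have "\<dots> = 81 * (1/S) * (1/Lmin) * (L * sqrt L) * (sqrt L / sqrt \<sigma>) * (real \<tau>)\<^sup>2"
    using S_pos min_lip_pos kap L32 grad_lip_pos
    by (simp add: powr_minus_divide powr_half_sqrt kappa_def real_sqrt_divide)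
  finally have "\<psi>\<^sup>2 = 81 * (1/S) * (1/Lmin) * (L * sqrt L) * (sqrt L / sqrt \<sigma>) * (real \<tau>)\<^sup>2" .
  then show ?thesis
    using S_pos min_lip_pos sigma_pos grad_lip_pos by (simp add: power2_eq_square field_simps)
qed

text \<open>Insert \<open>\<psi> \<le> 3/7\<close> into \<open>psi_sq\<close>: the bound on \<open>\<psi>\<close> is a smallness condition on the rate, since
  a positive delay forces the problem to be badly conditioned relative to the delay.\<close>

lemma inv_cond_small:
  assumes "0 < \<tau>"
  shows "s * Lmin / \<sigma> \<le> \<psi> / 189" "441 * (real \<tau>)\<^sup>2 * s \<le> 1"
proof -
  have tau: "1 \<le> (real \<tau>)\<^sup>2" using assms by (simp add: Suc_leI)
  have psi: "0 < \<psi>" using assms psi_eq_0_iff psi_nonneg[of p] by linarith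
  have "\<psi>\<^sup>2 * (S * Lmin * sqrt \<sigma>) \<le> (3/7 * \<psi>) * (S * Lmin * sqrt \<sigma>)"
    using psi psi_le S_pos min_lip_pos sigma_pos
    by (intro mult_right_mono) (auto simp: power2_eq_square)
  then have A: "189 * (L\<^sup>2 * (real \<tau>)\<^sup>2) \<le> \<psi> * (S * Lmin * sqrt \<sigma>)"
    unfolding psi_sq by (simp add: mult_ac)
  have LL: "Lmin\<^sup>2 \<le> L\<^sup>2" using min_lip_le min_lip_pos by (simp add: power_mono)
  have "189 * Lmin\<^sup>2 \<le> 189 * (L\<^sup>2 * (real \<tau>)\<^sup>2)"
    using mult_mono[OF LL tau] by simp
  with A have "Lmin * (189 * Lmin) \<le> Lmin * (\<psi> * (S * sqrt \<sigma>))"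
    by (simp add: power2_eq_square mult_ac)
  then have B: "189 * Lmin \<le> \<psi> * (S * sqrt \<sigma>)"
    using min_lip_pos by simp
  have s1: "s * Lmin / \<sigma> = Lmin / (S * sqrt \<sigma>)"
    using sigma_pos S_pos by (simp add: inv_cond_def field_simps)
  show "s * Lmin / \<sigma> \<le> \<psi> / 189"
    unfolding s1 using B S_pos sigma_pos by (simp add: field_simps)
  have "\<sigma> * Lmin \<le> L * L"
    using sigma_le_min_lip min_lip_le sigma_pos by (intro mult_mono) auto
  then have "\<sigma> * Lmin * (real \<tau>)\<^sup>2 \<le> L\<^sup>2 * (real \<tau>)\<^sup>2"
    by (intro mult_right_mono) (auto simp: power2_eq_square)
  then have "189 * (\<sigma> * Lmin * (real \<tau>)\<^sup>2) \<le> \<psi> * (S * Lmin * sqrt \<sigma>)"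
    using A by linarith
  also have "\<dots> \<le> 3/7 * (S * Lmin * sqrt \<sigma>)"
    using psi_le S_pos min_lip_pos sigma_pos by (intro mult_right_mono) auto
  finally have "Lmin * (441 * (\<sigma> * (real \<tau>)\<^sup>2)) \<le> Lmin * (S * sqrt \<sigma>)"
    by (simp add: mult_ac)
  then have C: "441 * (\<sigma> * (real \<tau>)\<^sup>2) \<le> S * sqrt \<sigma>"
    using min_lip_pos by simp
  have s2: "441 * (real \<tau>)\<^sup>2 * s = 441 * (\<sigma> * (real \<tau>)\<^sup>2) / (S * sqrt \<sigma>)"
    using sigma_pos S_pos by (simp add: inv_cond_def field_simps)
  show "441 * (real \<tau>)\<^sup>2 * s \<le> 1"
    unfolding s2 using C S_pos sigma_pos by (simp add: divide_le_eq)
qed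

text \<open>The reduction of the step length is relative to \<open>(\<sigma> / L\<^sub>m\<^sub>i\<^sub>n)\<^sup>1\<^sup>/\<^sup>2\<close>, which is at most \<open>1\<close>.\<close>

lemma step_h_bounds: "1 - \<psi> / 2 \<le> step_h p" "step_h p \<le> 1"
proof -
  have "sqrt \<sigma> / sqrt Lmin \<le> 1"
    using sigma_le_min_lip sigma_pos min_lip_pos by simp
  then have "sqrt \<sigma> / sqrt Lmin * \<psi> \<le> 1 * \<psi>"
    using psi_nonneg[of p] by (intro mult_right_mono)
  moreover have "0 \<le> sqrt \<sigma> / sqrt Lmin * \<psi>"
    using sigma_pos min_lip_pos psi_nonneg[of p] by simp
  ultimately show "1 - \<psi> / 2 \<le> step_h p" "step_h p \<le> 1"
    unfolding step_h_def by auto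
qed


section \<open>One iteration, averaged over the blocks\<close>

definition x_next :: "nat \<Rightarrow> real ^ 'd \<Rightarrow> real ^ 'd \<Rightarrow> real ^ 'd" where
  "x_next i y g = y - (step_h p / blk_lip p i) *\<^sub>R blk_proj blk i g"

definition v_next :: "nat \<Rightarrow> real ^ 'd \<Rightarrow> real ^ 'd \<Rightarrow> real ^ 'd \<Rightarrow> real ^ 'd" where
  "v_next i v y g = beta p *\<^sub>R v + (1 - beta p) *\<^sub>R y
     - (1 / (sqrt \<sigma> * sqrt (blk_lip p i))) *\<^sub>R blk_proj blk i g"

definition y_next :: "nat \<Rightarrow> real ^ 'd \<Rightarrow> real ^ 'd \<Rightarrow> real ^ 'd \<Rightarrow> real ^ 'd" where
  "y_next i v y g = alpha p *\<^sub>R v_next i v y g + (1 - alpha p) *\<^sub>R x_next i y g"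

text \<open>The block probabilities turn the block gradients, weighted by \<open>1 / L\<^sub>i\<close>, into the one quadratic
  form that measures gradients in all three mean estimates below.\<close>

definition mean_sq :: "real ^ 'd \<Rightarrow> real" where
  "mean_sq g = (\<Sum>i<n. q i * ((norm (blk_proj blk i g))\<^sup>2 / blk_lip p i))"

lemma mean_sq_nonneg: "0 \<le> mean_sq g"
  unfolding mean_sq_def
  by (intro sum_nonneg mult_nonneg_nonneg divide_nonneg_nonneg)
     (auto intro: blk_prob_nonneg less_imp_le blk_lip_pos)

lemma mean_sq_le: "mean_sq g \<le> s / \<sigma> * (norm g)\<^sup>2"
proof -
  have "q i * (t / blk_lip p i) \<le> s / \<sigma> * t" if "i < n" "0 \<le> t" for i t
  proof -
    have pos: "0 < blk_lip p i" by (rule blk_lip_pos[OF that(1)])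
    have "sqrt \<sigma> \<le> sqrt (blk_lip p i)" using sigma_le_blk_lip[OF that(1)] by simp
    then have "1 / (S * sqrt (blk_lip p i)) \<le> 1 / (S * sqrt \<sigma>)"
      using S_pos sigma_pos by (intro divide_left_mono mult_left_mono mult_pos_pos) (auto simp: pos)
    moreover have "q i / blk_lip p i = 1 / (S * sqrt (blk_lip p i))"
      using pos S_pos by (simp add: blk_prob_def field_simps)
    moreover have "s / \<sigma> = 1 / (S * sqrt \<sigma>)"
      using sigma_pos S_pos by (simp add: inv_cond_def field_simps)
    ultimately have "q i / blk_lip p i \<le> s / \<sigma>" by simp
    then show ?thesis using mult_right_mono[OF _ that(2)] by fastforce
  qed
  then have "mean_sq g \<le> (\<Sum>i<n. s / \<sigma> * (norm (blk_proj blk i g))\<^sup>2)"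
    unfolding mean_sq_def by (intro sum_mono) auto
  also have "\<dots> = s / \<sigma> * (norm g)\<^sup>2"
    unfolding sum_distrib_left[symmetric] using blocks by (simp add: sum_norm_blk_proj_sq)
  finally show ?thesis .
qed

text \<open>The step length of \<open>v\<close> is inversely proportional to the probability of the block, so that the
  cross terms add up to the scalar product with the full vector \<open>g\<close>.\<close>

lemma mean_v_next:
  "(\<Sum>i<n. q i * (norm (v_next i v y g))\<^sup>2)
    = (norm (beta p *\<^sub>R v + (1 - beta p) *\<^sub>R y))\<^sup>2
      - 2 * s / \<sigma> * ((beta p *\<^sub>R v + (1 - beta p) *\<^sub>R y) \<bullet> g) + mean_sq g / \<sigma>"
proof -
  define w where "w = beta p *\<^sub>R v + (1 - beta p) *\<^sub>R y"
  have "q i * (norm (v_next i v y g))\<^sup>2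
      = q i * (norm w)\<^sup>2 - 2 * s / \<sigma> * (w \<bullet> blk_proj blk i g)
        + q i * ((norm (blk_proj blk i g))\<^sup>2 / blk_lip p i) / \<sigma>" if "i < n" for i
  proof -
    have pos: "0 < blk_lip p i" by (rule blk_lip_pos[OF that])
    define a where "a = 1 / (sqrt \<sigma> * sqrt (blk_lip p i))"
    have nv: "(norm (v_next i v y g))\<^sup>2
        = (norm w)\<^sup>2 - 2 * a * (w \<bullet> blk_proj blk i g) + a\<^sup>2 * (norm (blk_proj blk i g))\<^sup>2"
      unfolding v_next_def w_def[symmetric] a_def[symmetric] power2_norm_eq_inner
      by (simp add: inner_diff_left inner_diff_right inner_commute power2_eq_square)
    have a2: "a\<^sup>2 = 1 / (\<sigma> * blk_lip p i)"
      using pos sigma_pos by (simp add: a_def power_divide power_mult_distrib)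
    have qa: "2 * s / \<sigma> = 2 * (q i * a)"
      using pos sigma_pos S_pos by (simp add: a_def blk_prob_def inv_cond_def field_simps)
    show ?thesis
      unfolding nv qa a2 by (simp add: algebra_simps)
  qed
  then have "(\<Sum>i<n. q i * (norm (v_next i v y g))\<^sup>2)
      = (\<Sum>i<n. q i) * (norm w)\<^sup>2 - 2 * s / \<sigma> * (\<Sum>i<n. w \<bullet> blk_proj blk i g) + mean_sq g / \<sigma>"
    by (simp add: sum.distrib sum_subtractf sum_distrib_left sum_distrib_right
        sum_divide_distrib mean_sq_def)
  then show ?thesis
    using blocks by (simp add: sum_blk_prob sum_inner_blk_proj w_def)
qed

text \<open>The descent inequality of the chosen block, with \<open>\<nabla>f(y)\<close> replaced by the stale gradient and
  the discrepancy split by Young's inequality with weight \<open>d\<close>. For \<open>d = 0\<close> the last summand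
  vanishes because division by \<open>0\<close> yields \<open>0\<close>, which is the correct value when \<open>g\<close> is not stale.\<close>

lemma mean_f_x_next:
  assumes d: "0 \<le> d" and stale: "d = 0 \<Longrightarrow> g = grad y"
  shows "(\<Sum>i<n. q i * f (x_next i y g))
    \<le> f y - (step_h p - (step_h p)\<^sup>2 / 2 - step_h p * d / 2) * mean_sq g
      + step_h p / (2 * d) * mean_sq (grad y - g)"
proof -
  define h where "h = step_h p"
  have h: "0 \<le> h" using step_h_bounds psi_le by (simp add: h_def)
  have one: "f (x_next i y g)
      \<le> f y - (h - h\<^sup>2 / 2 - h * d / 2) * ((norm (blk_proj blk i g))\<^sup>2 / blk_lip p i)
        + h / (2 * d) * ((norm (blk_proj blk i (grad y - g)))\<^sup>2 / blk_lip p i)" if "i < n" for i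
  proof -
    have pos: "0 < blk_lip p i" by (rule blk_lip_pos[OF that])
    define P where "P = blk_proj blk i g"
    define E where "E = blk_proj blk i (grad y - g)"
    have young: "- (E \<bullet> P) \<le> d / 2 * (norm P)\<^sup>2 + 1 / (2 * d) * (norm E)\<^sup>2"
    proof (cases "d = 0")
      case True
      then show ?thesis using stale by (simp add: E_def)
    next
      case False
      then have d: "0 < d" using d by simp
      have "0 \<le> (norm (d *\<^sub>R P + E))\<^sup>2 / (2 * d)" using d by simp
      also have "\<dots> = d / 2 * (norm P)\<^sup>2 + E \<bullet> P + 1 / (2 * d) * (norm E)\<^sup>2"
        using d unfolding power2_norm_eq_inner
        by (simp add: inner_add_left inner_add_right inner_commute field_simps)
      finally show ?thesis by simp
    qed
    have quad: "- h * ((norm P)\<^sup>2 + E \<bullet> P) + h\<^sup>2 / 2 * (norm P)\<^sup>2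
        \<le> h / (2 * d) * (norm E)\<^sup>2 - (h - h\<^sup>2 / 2 - h * d / 2) * (norm P)\<^sup>2"
    proof -
      have "- h * ((norm P)\<^sup>2 + E \<bullet> P) + h\<^sup>2 / 2 * (norm P)\<^sup>2
          = - h * (norm P)\<^sup>2 + h\<^sup>2 / 2 * (norm P)\<^sup>2 + h * - (E \<bullet> P)"
        by (simp add: algebra_simps)
      also have "\<dots> \<le> - h * (norm P)\<^sup>2 + h\<^sup>2 / 2 * (norm P)\<^sup>2
          + h * (d / 2 * (norm P)\<^sup>2 + 1 / (2 * d) * (norm E)\<^sup>2)"
        using mult_left_mono[OF young h] by (rule add_left_mono)
      also have "\<dots> = h / (2 * d) * (norm E)\<^sup>2 - (h - h\<^sup>2 / 2 - h * d / 2) * (norm P)\<^sup>2"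
        by (simp add: algebra_simps)
      finally show ?thesis .
    qed
    have "f (x_next i y g) = f (y + blk_proj blk i ((- h / blk_lip p i) *\<^sub>R g))"
      unfolding blk_proj_scaleR by (simp add: x_next_def h_def)
    also have "\<dots> \<le> f y + grad y \<bullet> ((- h / blk_lip p i) *\<^sub>R P)
        + blk_lip p i / 2 * (norm ((- h / blk_lip p i) *\<^sub>R P))\<^sup>2"
      using block_descent[OF that, of y "(- h / blk_lip p i) *\<^sub>R g"]
      unfolding blk_proj_scaleR P_def .
    also have "\<dots> = f y + (- h * (grad y \<bullet> P) + h\<^sup>2 / 2 * (norm P)\<^sup>2) / blk_lip p i"
      using pos by (simp add: field_simps power2_eq_square)
    also have "grad y \<bullet> P = (norm P)\<^sup>2 + E \<bullet> P"
      by (simp add: P_def E_def norm_blk_proj_sq blk_proj_inner_blk_proj inner_diff_left)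
    also have "(- h * ((norm P)\<^sup>2 + E \<bullet> P) + h\<^sup>2 / 2 * (norm P)\<^sup>2) / blk_lip p i
        \<le> (h / (2 * d) * (norm E)\<^sup>2 - (h - h\<^sup>2 / 2 - h * d / 2) * (norm P)\<^sup>2) / blk_lip p i"
      using pos quad by (intro divide_right_mono) auto
    finally show ?thesis
      by (simp add: P_def E_def add_divide_distrib diff_divide_distrib)
  qed
  have "(\<Sum>i<n. q i * f (x_next i y g))
    \<le> (\<Sum>i<n. q i * (f y - (h - h\<^sup>2 / 2 - h * d / 2) * ((norm (blk_proj blk i g))\<^sup>2 / blk_lip p i)
        + h / (2 * d) * ((norm (blk_proj blk i (grad y - g)))\<^sup>2 / blk_lip p i)))"
    using one blk_prob_nonneg by (intro sum_mono mult_left_mono) auto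
  also have "\<dots> = (\<Sum>i<n. q i) * f y - (h - h\<^sup>2 / 2 - h * d / 2) * mean_sq g
      + h / (2 * d) * mean_sq (grad y - g)"
    unfolding mean_sq_def sum_distrib_left sum_distrib_right sum.distrib[symmetric]
      sum_subtractf[symmetric]
    by (intro sum.cong refl) (simp add: algebra_simps add_divide_distrib)
  finally show ?thesis by (simp add: sum_blk_prob h_def)
qed

text \<open>The left-hand side is the coefficient of the block gradient in \<open>y\<^sub>k\<^sub>+\<^sub>1 - y\<^sub>k\<close>. The block with
  the smallest \<open>L\<^sub>i\<close> is the critical one. In units of \<open>1 / L\<^sub>m\<^sub>i\<^sub>n\<close> its coefficient is
  \<open>\<alpha> r + (1 - \<alpha>) h\<close> with \<open>r = (L\<^sub>m\<^sub>i\<^sub>n / \<sigma>)\<^sup>1\<^sup>/\<^sup>2\<close>. For \<open>h = 1\<close> this would exceed \<open>1\<close> by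
  \<open>\<alpha> (r - 1)\<close>; the shortened step length compensates for the excess.\<close>

lemma extrapolated_step_le:
  assumes "i < n" "0 < \<tau>"
  shows "alpha p / (sqrt \<sigma> * sqrt (blk_lip p i)) + (1 - alpha p) * step_h p / blk_lip p i
    \<le> 1 / (sqrt (blk_lip p i) * sqrt Lmin)"
proof -
  define r where "r = sqrt Lmin / sqrt \<sigma>"
  have r: "1 \<le> r" using sigma_le_min_lip sigma_pos by (simp add: r_def)
  have pos: "0 < blk_lip p i" by (rule blk_lip_pos[OF assms(1)])
  have psi: "0 \<le> \<psi>" by (rule psi_nonneg)
  have r2: "r\<^sup>2 = Lmin / \<sigma>" using sigma_pos min_lip_pos by (simp add: r_def power_divide)
  have "s * r\<^sup>2 \<le> \<psi> / 2" using inv_cond_small(1)[OF assms(2)] psi by (simp add: r2)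
  moreover have "s * r * (r - 1) \<le> s * r\<^sup>2"
    using inv_cond_pos r by (simp add: power2_eq_square algebra_simps)
  moreover have "(1 + \<psi>) * (\<psi> / 2) \<ge> \<psi> / 2" using psi by (simp add: algebra_simps)
  ultimately have "s * r * (r - 1) \<le> (1 + \<psi>) * (\<psi> / 2)" by linarith
  then have *: "s * (r - 1) \<le> (1 + \<psi>) * (\<psi> / (2 * r))"
    using r by (simp add: field_simps)
  have D: "0 < s + (1 + \<psi>)" using inv_cond_pos psi by linarith
  have al: "1 - alpha p = (1 + \<psi>) / (s + (1 + \<psi>))"
    unfolding alpha_eq using D by (simp add: field_simps)
  have h: "step_h p = 1 - \<psi> / (2 * r)"
    using min_lip_pos sigma_pos by (simp add: step_h_def r_def field_simps)
  have "alpha p * (r - 1) \<le> (1 - alpha p) * (\<psi> / (2 * r))"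
    using divide_right_mono[OF *, of "s + (1 + \<psi>)"] D unfolding al
    unfolding alpha_eq by (simp add: mult_ac)
  then have main: "alpha p * r + (1 - alpha p) * step_h p \<le> 1"
    unfolding h by (simp add: algebra_simps)
  have m: "sqrt Lmin \<le> sqrt (blk_lip p i)" using min_lip_le_blk[OF assms(1)] by simp
  have hb: "0 \<le> step_h p" using step_h_bounds(1) psi_le by simp
  have "sqrt (blk_lip p i) * sqrt Lmin \<le> sqrt (blk_lip p i) * sqrt (blk_lip p i)"
    using m pos by (intro mult_left_mono) auto
  then have "(1 - alpha p) * step_h p / blk_lip p i
      \<le> (1 - alpha p) * step_h p / (sqrt (blk_lip p i) * sqrt Lmin)"
    using pos min_lip_pos alpha_bounds hb by (intro divide_left_mono mult_nonneg_nonneg) auto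
  moreover have "alpha p / (sqrt \<sigma> * sqrt (blk_lip p i))
      = alpha p * r / (sqrt (blk_lip p i) * sqrt Lmin)"
    using pos min_lip_pos sigma_pos by (simp add: r_def field_simps)
  moreover have "alpha p * r / (sqrt (blk_lip p i) * sqrt Lmin)
      + (1 - alpha p) * step_h p / (sqrt (blk_lip p i) * sqrt Lmin)
      \<le> 1 / (sqrt (blk_lip p i) * sqrt Lmin)"
    unfolding add_divide_distrib[symmetric] using main pos min_lip_pos
    by (intro divide_right_mono) auto
  ultimately show ?thesis by linarith
qed

lemma mean_y_next:
  assumes "0 < \<tau>"
  shows "(\<Sum>i<n. q i * (norm (y_next i v y g - y))\<^sup>2)
    \<le> 2 * (alpha p * beta p)\<^sup>2 * (norm (v - y))\<^sup>2 + 2 / Lmin * mean_sq g"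
proof -
  have one: "(norm (y_next i v y g - y))\<^sup>2 \<le> 2 * (alpha p * beta p)\<^sup>2 * (norm (v - y))\<^sup>2
      + 2 / Lmin * ((norm (blk_proj blk i g))\<^sup>2 / blk_lip p i)" if "i < n" for i
  proof -
    have pos: "0 < blk_lip p i" by (rule blk_lip_pos[OF that])
    define b where
      "b = alpha p / (sqrt \<sigma> * sqrt (blk_lip p i)) + (1 - alpha p) * step_h p / blk_lip p i"
    define U where "U = (alpha p * beta p) *\<^sub>R (v - y)"
    define W where "W = b *\<^sub>R blk_proj blk i g"
    have "0 \<le> step_h p" using step_h_bounds(1) psi_le by simp
    then have b: "0 \<le> b"
      using alpha_bounds pos sigma_pos unfolding b_def by (intro add_nonneg_nonneg) auto
    have "b\<^sup>2 \<le> (1 / (sqrt (blk_lip p i) * sqrt Lmin))\<^sup>2"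
      using extrapolated_step_le[OF that assms] b by (intro power_mono) (auto simp: b_def)
    also have "\<dots> = 1 / (blk_lip p i * Lmin)"
      using pos min_lip_pos by (simp add: power_divide power_mult_distrib)
    finally have b2: "b\<^sup>2 * (norm (blk_proj blk i g))\<^sup>2
        \<le> 1 / (blk_lip p i * Lmin) * (norm (blk_proj blk i g))\<^sup>2"
      by (intro mult_right_mono) auto
    have "y_next i v y g - y = U - W"
      unfolding y_next_def v_next_def x_next_def U_def W_def b_def
      by (simp add: algebra_simps)
    moreover have "(norm (U - W))\<^sup>2 \<le> 2 * (norm U)\<^sup>2 + 2 * (norm W)\<^sup>2"
    proof -
      have "(norm (U - W))\<^sup>2 + (norm (U + W))\<^sup>2 = 2 * (norm U)\<^sup>2 + 2 * (norm W)\<^sup>2"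
        unfolding power2_norm_eq_inner by (simp add: algebra_simps inner_simps)
      then show ?thesis by (smt (verit) zero_le_power2)
    qed
    ultimately have "(norm (y_next i v y g - y))\<^sup>2
        \<le> 2 * ((alpha p * beta p)\<^sup>2 * (norm (v - y))\<^sup>2)
          + 2 * (b\<^sup>2 * (norm (blk_proj blk i g))\<^sup>2)"
      by (simp add: U_def W_def power_mult_distrib)
    also have "\<dots> \<le> 2 * ((alpha p * beta p)\<^sup>2 * (norm (v - y))\<^sup>2)
          + 2 * (1 / (blk_lip p i * Lmin) * (norm (blk_proj blk i g))\<^sup>2)"
      using b2 by simp
    finally show ?thesis by (simp add: mult_ac)
  qed
  have "(\<Sum>i<n. q i * (norm (y_next i v y g - y))\<^sup>2)
      \<le> (\<Sum>i<n. q i * (2 * (alpha p * beta p)\<^sup>2 * (norm (v - y))\<^sup>2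
      + 2 / Lmin * ((norm (blk_proj blk i g))\<^sup>2 / blk_lip p i)))"
    using one blk_prob_nonneg by (intro sum_mono mult_left_mono) auto
  also have "\<dots> = (\<Sum>i<n. q i) * (2 * (alpha p * beta p)\<^sup>2 * (norm (v - y))\<^sup>2)
      + 2 / Lmin * mean_sq g"
    unfolding mean_sq_def sum_distrib_left sum_distrib_right sum.distrib[symmetric]
    by (intro sum.cong refl) (simp add: algebra_simps)
  finally show ?thesis by (simp add: sum_blk_prob)
qed

text \<open>The part of the estimate that is free of squares of \<open>g\<close>. With \<open>z = v - y\<close> one has
  \<open>w = y + \<beta> z\<close>, and the scalar products with \<open>y\<close> and with \<open>z\<close> are treated separately: the first
  by strong convexity between \<open>y\<close> and the minimizer, the second through
  \<open>s z = (1 + \<psi>) (y - x)\<close>. Nine tenths of the available multiple of \<open>\<parallel>z\<parallel>\<^sup>2\<close> are spent on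
  staleness; the last tenth is kept for the motion of \<open>y\<close>.\<close>

lemma drift_of_v:
  assumes y: "y = alpha p *\<^sub>R v + (1 - alpha p) *\<^sub>R x"
    and stale: "\<psi> = 0 \<Longrightarrow> g = grad y"
  defines "w \<equiv> beta p *\<^sub>R v + (1 - beta p) *\<^sub>R y"
  shows "(norm w)\<^sup>2 - 2 * s / \<sigma> * (w \<bullet> g)
    \<le> beta p * ((norm v)\<^sup>2 + c_fun p * f x) - c_fun p * f y
      - beta p * (1 - \<psi>) * s / 10 * (norm (v - y))\<^sup>2
      + 11 / 6 * (s / (\<sigma>\<^sup>2 * \<psi>)) * (norm (grad y - g))\<^sup>2"
proof -
  define z where "z = v - y"
  define b where "b = beta p"
  define e where "e = grad y - g"
  have b: "0 \<le> b" "b \<le> 1" using beta_bounds by (simp_all add: b_def)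
  have rho: "1 - b = (1 - \<psi>) * s" by (simp add: b_def beta_eq)
  have w: "w = y + b *\<^sub>R z"
    by (simp add: w_def b_def z_def algebra_simps)
  have psi: "0 \<le> \<psi>" "\<psi> \<le> 3/7" using psi_nonneg psi_le by auto
  have s: "0 < s" "s \<le> 1" using inv_cond_pos inv_cond_le_1 by auto

  have "(norm w)\<^sup>2 = b * (norm v)\<^sup>2 + (1 - b) * (norm y)\<^sup>2 - b * (1 - b) * (norm z)\<^sup>2"
    unfolding w_def b_def[symmetric] z_def power2_norm_eq_inner
    by (simp add: inner_simps inner_commute algebra_simps)
  then have norm_w: "(norm w)\<^sup>2 = b * (norm v)\<^sup>2 + (1 - \<psi>) * s * (norm y)\<^sup>2
      - b * ((1 - \<psi>) * s) * (norm z)\<^sup>2"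
    by (simp add: rho)

  \<comment> \<open>\<open>f(0) = 0\<close>, so this is strong convexity between \<open>y\<close> and the minimizer\<close>
  have yG: "- (grad y \<bullet> y) \<le> - f y - \<sigma> / 2 * (norm y)\<^sup>2"
    using convex_lower[of y 0] minimum by simp
  have zG: "- (z \<bullet> grad y) \<le> (1 + \<psi>) / s * (f x - f y)"
  proof -
    have D: "0 < s + (1 + \<psi>)" using s psi by linarith
    have "alpha p *\<^sub>R z = (1 - alpha p) *\<^sub>R (y - x)"
      using y by (simp add: z_def algebra_simps)
    moreover have "alpha p = s / (s + (1 + \<psi>))" "1 - alpha p = (1 + \<psi>) / (s + (1 + \<psi>))"
      unfolding alpha_eq using D by (simp_all add: field_simps)
    ultimately have "(s + (1 + \<psi>)) *\<^sub>R ((s / (s + (1 + \<psi>))) *\<^sub>R z)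
        = (s + (1 + \<psi>)) *\<^sub>R (((1 + \<psi>) / (s + (1 + \<psi>))) *\<^sub>R (y - x))"
      by simp
    then have "s *\<^sub>R z = (1 + \<psi>) *\<^sub>R (y - x)"
      using D by simp
    then have "s * (z \<bullet> grad y) = (1 + \<psi>) * ((y - x) \<bullet> grad y)"
      by (metis inner_scaleR_left)
    moreover have "f y - f x \<le> (y - x) \<bullet> grad y"
    proof -
      have "0 \<le> \<sigma> / 2 * (norm (x - y))\<^sup>2" using sigma_pos by simp
      then show ?thesis using convex_lower[of y x] by (simp add: inner_simps inner_commute)
    qed
    then have "(1 + \<psi>) * (f y - f x) \<le> (1 + \<psi>) * ((y - x) \<bullet> grad y)"
      using psi by (intro mult_left_mono) auto
    ultimately show ?thesis
      using s by (simp add: field_simps)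
  qed
  have main: "2 * s / \<sigma> * - (w \<bullet> grad y)
      \<le> b * c_fun p * f x - c_fun p * f y - s * (norm y)\<^sup>2"
  proof -
    have "- (w \<bullet> grad y) = - (grad y \<bullet> y) + b * - (z \<bullet> grad y)"
      by (simp add: w inner_simps inner_commute)
    also have "\<dots> \<le> (- f y - \<sigma> / 2 * (norm y)\<^sup>2) + b * ((1 + \<psi>) / s * (f x - f y))"
      using yG zG b by (intro add_mono mult_left_mono) auto
    finally have "2 * s / \<sigma> * - (w \<bullet> grad y) \<le> 2 * s / \<sigma> *
        ((- f y - \<sigma> / 2 * (norm y)\<^sup>2) + b * ((1 + \<psi>) / s * (f x - f y)))"
      using s sigma_pos by (intro mult_left_mono) auto
    also have "\<dots> = b * (2 / \<sigma> * (1 + \<psi>)) * f x - 2 / \<sigma> * (b * (1 + \<psi>) + s) * f y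
        - s * (norm y)\<^sup>2"
      using s sigma_pos by (simp add: field_simps)
    also have "2 / \<sigma> * (b * (1 + \<psi>) + s) = c_fun p"
      using rho by (simp add: c_fun_eq b_def beta_eq algebra_simps power2_eq_square)
    also have "b * (2 / \<sigma> * (1 + \<psi>)) * f x \<le> b * c_fun p * f x"
      using b s psi sigma_pos f_nonneg unfolding c_fun_eq
      by (intro mult_right_mono mult_left_mono) auto
    finally show ?thesis by simp
  qed
  \<comment> \<open>the coefficient \<open>11/6\<close> is \<open>1\<close> from the scalar product with \<open>y\<close> plus \<open>5/6\<close> from that with \<open>z\<close>\<close>
  have err: "2 * s / \<sigma> * (w \<bullet> e) \<le> \<psi> * s * (norm y)\<^sup>2
      + b * (9 / 10 * ((1 - \<psi>) * s)) * (norm z)\<^sup>2 + 11 / 6 * (s / (\<sigma>\<^sup>2 * \<psi>)) * (norm e)\<^sup>2"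
  proof (cases "\<psi> = 0")
    case True
    then have "e = 0" using stale by (simp add: e_def)
    then show ?thesis using b s True by simp
  next
    case False
    then have psi0: "0 < \<psi>" using psi by simp
    have "2 * (y \<bullet> e) \<le> (\<psi> * \<sigma>) * (norm y)\<^sup>2 + (norm e)\<^sup>2 / (\<psi> * \<sigma>)"
      using psi0 sigma_pos by (intro inner_young) auto
    then have 1: "s / \<sigma> * (2 * (y \<bullet> e))
        \<le> s / \<sigma> * ((\<psi> * \<sigma>) * (norm y)\<^sup>2 + (norm e)\<^sup>2 / (\<psi> * \<sigma>))"
      using s sigma_pos by (intro mult_left_mono) auto
    have "2 * (z \<bullet> e) \<le> (9 / 10 * (1 - \<psi>) * \<sigma>) * (norm z)\<^sup>2
        + (norm e)\<^sup>2 / (9 / 10 * (1 - \<psi>) * \<sigma>)"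
      using psi sigma_pos by (intro inner_young) auto
    also have "\<dots> \<le> (9 / 10 * (1 - \<psi>) * \<sigma>) * (norm z)\<^sup>2 + 5 / 6 * ((norm e)\<^sup>2 / (\<psi> * \<sigma>))"
    proof -
      have "6 / 5 * (\<psi> * \<sigma>) \<le> 9 / 10 * (1 - \<psi>) * \<sigma>" using psi sigma_pos by simp
      then have "(norm e)\<^sup>2 / (9 / 10 * (1 - \<psi>) * \<sigma>) \<le> (norm e)\<^sup>2 / (6 / 5 * (\<psi> * \<sigma>))"
        using psi0 psi sigma_pos by (intro divide_left_mono) auto
      then show ?thesis by simp
    qed
    finally have "b * (2 * (z \<bullet> e)) \<le> b * ((9 / 10 * (1 - \<psi>) * \<sigma>) * (norm z)\<^sup>2
        + 5 / 6 * ((norm e)\<^sup>2 / (\<psi> * \<sigma>)))"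
      using b(1) by (rule mult_left_mono)
    also have "\<dots> = b * ((9 / 10 * (1 - \<psi>) * \<sigma>) * (norm z)\<^sup>2)
        + b * (5 / 6 * ((norm e)\<^sup>2 / (\<psi> * \<sigma>)))"
      by (rule distrib_left)
    also have "b * (5 / 6 * ((norm e)\<^sup>2 / (\<psi> * \<sigma>))) \<le> 5 / 6 * ((norm e)\<^sup>2 / (\<psi> * \<sigma>))"
      using b psi0 sigma_pos by (intro mult_left_le_one_le) auto
    finally have "s / \<sigma> * (b * (2 * (z \<bullet> e)))
        \<le> s / \<sigma> * (b * ((9 / 10 * (1 - \<psi>) * \<sigma>) * (norm z)\<^sup>2)
          + 5 / 6 * ((norm e)\<^sup>2 / (\<psi> * \<sigma>)))"
      using s sigma_pos by (intro mult_left_mono) auto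
    with 1 have "s / \<sigma> * (2 * (y \<bullet> e)) + s / \<sigma> * (b * (2 * (z \<bullet> e)))
       \<le> s / \<sigma> * ((\<psi> * \<sigma>) * (norm y)\<^sup>2 + (norm e)\<^sup>2 / (\<psi> * \<sigma>)) +
         s / \<sigma> * (b * ((9 / 10 * (1 - \<psi>) * \<sigma>) * (norm z)\<^sup>2)
          + 5 / 6 * ((norm e)\<^sup>2 / (\<psi> * \<sigma>)))"
      by (rule add_mono)
    also have "\<dots> = \<psi> * s * (norm y)\<^sup>2
      + b * (9 / 10 * ((1 - \<psi>) * s)) * (norm z)\<^sup>2 + 11 / 6 * (s / (\<sigma>\<^sup>2 * \<psi>)) * (norm e)\<^sup>2"
      using psi0 sigma_pos by (simp add: field_simps power2_eq_square)
    also have "s / \<sigma> * (2 * (y \<bullet> e)) + s / \<sigma> * (b * (2 * (z \<bullet> e))) = 2 * s / \<sigma> * (w \<bullet> e)"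
      by (simp add: w inner_simps algebra_simps add_divide_distrib)
    finally show ?thesis .
  qed
  have wg: "w \<bullet> g = w \<bullet> grad y - w \<bullet> e" by (simp add: e_def inner_simps)
  have "(norm w)\<^sup>2 - 2 * s / \<sigma> * (w \<bullet> g)
      = (norm w)\<^sup>2 + 2 * s / \<sigma> * - (w \<bullet> grad y) + 2 * s / \<sigma> * (w \<bullet> e)"
    unfolding wg right_diff_distrib by simp
  also have "\<dots> \<le> (b * (norm v)\<^sup>2 + (1 - \<psi>) * s * (norm y)\<^sup>2
        - b * ((1 - \<psi>) * s) * (norm z)\<^sup>2)
      + (b * c_fun p * f x - c_fun p * f y - s * (norm y)\<^sup>2)
      + (\<psi> * s * (norm y)\<^sup>2 + b * (9 / 10 * ((1 - \<psi>) * s)) * (norm z)\<^sup>2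
          + 11 / 6 * (s / (\<sigma>\<^sup>2 * \<psi>)) * (norm e)\<^sup>2)"
    unfolding norm_w using main err by (intro add_mono) auto
  also have "\<dots> = b * ((norm v)\<^sup>2 + c_fun p * f x) - c_fun p * f y
      - b * (1 - \<psi>) * s / 10 * (norm z)\<^sup>2 + 11 / 6 * (s / (\<sigma>\<^sup>2 * \<psi>)) * (norm e)\<^sup>2"
    by (simp add: field_simps)
  finally show ?thesis unfolding z_def b_def e_def .
qed

text \<open>The left-hand side collects the positive coefficients of \<^term>\<open>mean_sq g\<close>, from \<open>v\<^sub>k\<^sub>+\<^sub>1\<close>
  and from the new increment of \<open>y\<close>; the right-hand side is the coefficient in the descent of
  \<open>c f\<close> for the weight \<open>d = 9/20 \<psi>\<close>. That weight is a compromise: a larger one would use up the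
  excess of \<open>c\<close> over \<open>2/\<sigma>\<close>, a smaller one would make staleness too expensive in
  \<open>stale_smoothness_cost\<close>.\<close>

lemma gradient_gain:
  assumes C: "C1 \<le> \<psi> * Lmin / (13 * \<sigma>)"
  shows "1 / \<sigma> + 2 * C1 / Lmin
    \<le> c_fun p * (step_h p - (step_h p)\<^sup>2 / 2 - step_h p * (9 / 20 * \<psi>) / 2)"
proof -
  have psi: "0 \<le> \<psi>" "\<psi> \<le> 3/7" using psi_nonneg psi_le by auto
  have s: "0 \<le> s" using inv_cond_pos by auto
  define gain where "gain = step_h p - (step_h p)\<^sup>2 / 2 - step_h p * (9 / 20 * \<psi>) / 2"
  define \<eta> where "\<eta> = 2 * gain"
  have "(1 - step_h p)\<^sup>2 \<le> (\<psi> / 2)\<^sup>2"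
    using step_h_bounds by (intro power_mono) auto
  moreover have "step_h p * (9 / 20 * \<psi>) \<le> 9 / 20 * \<psi>"
    using step_h_bounds psi by (intro mult_left_le_one_le) auto
  moreover have "\<eta> = 1 - (1 - step_h p)\<^sup>2 - step_h p * (9 / 20 * \<psi>)"
    by (simp add: \<eta>_def gain_def power2_eq_square algebra_simps)
  ultimately have eta: "1 - (\<psi> / 2)\<^sup>2 - 9 / 20 * \<psi> \<le> \<eta>" by linarith
  have sq: "\<psi> * \<psi> \<le> 3/7 * \<psi>" using psi by (intro mult_right_mono) auto
  then have eta0: "0 \<le> \<eta>" using eta psi by (simp add: power2_eq_square)
  have cube: "\<psi> * (\<psi> * \<psi>) \<le> 3/7 * (3/7 * \<psi>)"
    using psi sq by (intro mult_mono) auto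
  have "(1 + \<psi>) * (1 - (\<psi> / 2)\<^sup>2 - 9 / 20 * \<psi>)
      = 1 + 11 / 20 * \<psi> - 7 / 10 * (\<psi> * \<psi>) - 1 / 4 * (\<psi> * (\<psi> * \<psi>))"
    by (simp add: power2_eq_square field_simps)
  then have "1 + 2 / 13 * \<psi> \<le> (1 + \<psi>) * (1 - (\<psi> / 2)\<^sup>2 - 9 / 20 * \<psi>)"
    using psi sq cube by linarith
  also have "\<dots> \<le> (1 + \<psi>) * \<eta>" using eta psi by (intro mult_left_mono) auto
  also have "\<dots> \<le> (1 + \<psi> + \<psi>\<^sup>2 * s) * \<eta>" using eta0 s by (intro mult_right_mono) auto
  finally have "1 / \<sigma> * (1 + 2 / 13 * \<psi>) \<le> 1 / \<sigma> * ((1 + \<psi> + \<psi>\<^sup>2 * s) * \<eta>)"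
    using sigma_pos by (intro mult_left_mono) auto
  moreover have "2 * C1 / Lmin \<le> 2 * (\<psi> * Lmin / (13 * \<sigma>)) / Lmin"
    using C min_lip_pos by (intro divide_right_mono mult_left_mono) auto
  then have "2 * C1 / Lmin \<le> 1 / \<sigma> * (2 / 13 * \<psi>)"
    using min_lip_pos by simp
  moreover have "c_fun p * gain
      = 1 / \<sigma> * ((1 + \<psi> + \<psi>\<^sup>2 * s) * \<eta>)"
    by (simp add: c_fun_eq \<eta>_def)
  moreover have "1 / \<sigma> * (1 + 2 / 13 * \<psi>) = 1 / \<sigma> + 1 / \<sigma> * (2 / 13 * \<psi>)"
    by (simp add: distrib_left)
  ultimately show ?thesis unfolding gain_def[symmetric] by linarith
qed

text \<open>The price of staleness in the descent inequality for \<open>x\<^sub>k\<^sub>+\<^sub>1\<close>. Together with the \<open>11/6\<close> from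
  \<open>drift_of_v\<close> it stays below \<open>6\<close>.\<close>

lemma stale_smoothness_cost:
  "c_fun p * (step_h p / (2 * (9 / 20 * \<psi>)) * (s / \<sigma>)) \<le> 4 * (s / (\<sigma>\<^sup>2 * \<psi>))"
proof (cases "\<psi> = 0")
  case False
  have psi: "0 < \<psi>" "\<psi> \<le> 3/7" using False psi_nonneg[of p] psi_le by auto
  have s: "0 < s" "s \<le> 1" using inv_cond_pos inv_cond_le_1 by auto
  have "\<psi>\<^sup>2 * s \<le> (3/7)\<^sup>2 * 1" using psi s by (intro mult_mono power_mono) auto
  then have "1 + \<psi> + \<psi>\<^sup>2 * s \<le> 9 / 5" using psi by (simp add: power2_eq_square)
  then have "(1 + \<psi> + \<psi>\<^sup>2 * s) * step_h p \<le> 9 / 5 * 1"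
    using step_h_bounds psi s by (intro mult_mono) auto
  then have "(1 + \<psi> + \<psi>\<^sup>2 * s) * step_h p * (20 / 9 * (s / (\<sigma>\<^sup>2 * \<psi>)))
      \<le> 9 / 5 * (20 / 9 * (s / (\<sigma>\<^sup>2 * \<psi>)))"
    using psi s sigma_pos by (intro mult_right_mono) auto
  then show ?thesis
    using psi sigma_pos by (simp add: c_fun_eq power2_eq_square field_simps)
qed simp

text \<open>The constant \<open>C1\<close> stands for the first coefficient \<open>c\<^sub>1\<close> of the asynchronicity error.\<close>

lemma one_step_mean:
  assumes y: "y = alpha p *\<^sub>R v + (1 - alpha p) *\<^sub>R x"
    and stale: "\<tau> = 0 \<Longrightarrow> g = grad y"
    and C: "0 \<le> C1" "C1 \<le> \<psi> * Lmin / (13 * \<sigma>)"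
  shows "(\<Sum>i<n. q i * ((norm (v_next i v y g))\<^sup>2 + C1 * (norm (y_next i v y g - y))\<^sup>2
      + c_fun p * f (x_next i y g)))
    \<le> beta p * ((norm v)\<^sup>2 + c_fun p * f x) + 6 * (s / (\<sigma>\<^sup>2 * \<psi>)) * (norm (grad y - g))\<^sup>2"
proof -
  define E where "E = (norm (grad y - g))\<^sup>2"
  define Z where "Z = (norm (v - y))\<^sup>2"
  define h where "h = step_h p"
  define d where "d = 9 / 20 * \<psi>"
  have psi: "0 \<le> \<psi>" "\<psi> \<le> 3/7" using psi_nonneg psi_le by auto
  have s: "0 < s" "s \<le> 1" using inv_cond_pos inv_cond_le_1 by auto
  have c: "0 \<le> c_fun p" by (rule c_fun_nonneg)
  have stale': "\<psi> = 0 \<Longrightarrow> g = grad y" using stale psi_eq_0_iff by simp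
  have E0: "0 \<le> E" and Z0: "0 \<le> Z" by (simp_all add: E_def Z_def)
  have Y: "C1 * (\<Sum>i<n. q i * (norm (y_next i v y g - y))\<^sup>2)
      \<le> beta p * (1 - \<psi>) * s / 10 * Z + 2 * C1 / Lmin * mean_sq g"
  proof (cases "\<tau> = 0")
    case True
    then have "C1 = 0" using C psi_eq_0_iff by simp
    then show ?thesis using Z0 beta_bounds psi s by simp
  next
    case False
    then have tau: "0 < \<tau>" by simp
    have ab: "(alpha p)\<^sup>2 \<le> s * s"
      using alpha_bounds by (simp add: power2_eq_square mult_mono)
    have b2: "(beta p)\<^sup>2 \<le> beta p"
      using beta_bounds by (simp add: power2_eq_square mult_left_le_one_le)
    \<comment> \<open>the increment of \<open>y\<close> due to \<open>v - y\<close> is of second order in \<open>s\<close>, hence below the reserved tenth\<close>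
    have "C1 * s \<le> \<psi> * Lmin / (13 * \<sigma>) * s"
      using C s by (intro mult_right_mono) auto
    also have "\<dots> = \<psi> / 13 * (s * Lmin / \<sigma>)" by simp
    also have "\<dots> \<le> \<psi> / 13 * (\<psi> / 189)"
      using inv_cond_small(1)[OF tau] psi by (intro mult_left_mono) auto
    also have "\<dots> \<le> (3/7) / 13 * ((3/7) / 189)" using psi by (intro mult_mono) auto
    also have "\<dots> \<le> (1 - \<psi>) / 20" using psi by simp
    finally have C1s: "2 * (C1 * s) \<le> (1 - \<psi>) / 10" by simp
    have "2 * C1 * (alpha p * beta p)\<^sup>2 \<le> 2 * C1 * (s * s * beta p)"
      using ab b2 C s unfolding power_mult_distrib
      by (intro mult_left_mono mult_mono) auto
    also have "\<dots> = 2 * (C1 * s) * (s * beta p)" by simp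
    also have "\<dots> \<le> (1 - \<psi>) / 10 * (s * beta p)"
      using C1s s beta_bounds by (intro mult_right_mono) auto
    finally have "2 * C1 * (alpha p * beta p)\<^sup>2 * Z \<le> (1 - \<psi>) / 10 * (s * beta p) * Z"
      using Z0 by (rule mult_right_mono)
    moreover have "C1 * (\<Sum>i<n. q i * (norm (y_next i v y g - y))\<^sup>2)
        \<le> C1 * (2 * (alpha p * beta p)\<^sup>2 * Z + 2 / Lmin * mean_sq g)"
      unfolding Z_def using mean_y_next[OF tau] C by (intro mult_left_mono) auto
    moreover have "C1 * (2 * (alpha p * beta p)\<^sup>2 * Z + 2 / Lmin * mean_sq g)
        = 2 * C1 * (alpha p * beta p)\<^sup>2 * Z + 2 * C1 / Lmin * mean_sq g"
      by (simp add: algebra_simps)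
    moreover have "(1 - \<psi>) / 10 * (s * beta p) * Z = beta p * (1 - \<psi>) * s / 10 * Z"
      by simp
    ultimately show ?thesis by linarith
  qed
  have F: "c_fun p * (\<Sum>i<n. q i * f (x_next i y g))
      \<le> c_fun p * f y - c_fun p * (h - h\<^sup>2 / 2 - h * d / 2) * mean_sq g + 4 * (s / (\<sigma>\<^sup>2 * \<psi>)) * E"
  proof -
    have "(\<Sum>i<n. q i * f (x_next i y g))
        \<le> f y - (h - h\<^sup>2 / 2 - h * d / 2) * mean_sq g + h / (2 * d) * mean_sq (grad y - g)"
      unfolding h_def using psi stale' by (intro mean_f_x_next) (auto simp: d_def)
    also have "h / (2 * d) * mean_sq (grad y - g) \<le> h / (2 * d) * (s / \<sigma> * E)"
      unfolding E_def using step_h_bounds psi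
      by (intro mult_left_mono mean_sq_le) (auto simp: h_def d_def)
    finally have "c_fun p * (\<Sum>i<n. q i * f (x_next i y g))
        \<le> c_fun p * (f y - (h - h\<^sup>2 / 2 - h * d / 2) * mean_sq g + h / (2 * d) * (s / \<sigma> * E))"
      using c by (simp add: mult_left_mono)
    also have "\<dots> = c_fun p * f y - c_fun p * (h - h\<^sup>2 / 2 - h * d / 2) * mean_sq g
        + c_fun p * (h / (2 * d) * (s / \<sigma>)) * E"
      by (simp add: algebra_simps)
    also have "c_fun p * (h / (2 * d) * (s / \<sigma>)) * E \<le> 4 * (s / (\<sigma>\<^sup>2 * \<psi>)) * E"
      using stale_smoothness_cost E0 unfolding h_def d_def by (rule mult_right_mono)
    finally show ?thesis by simp
  qed
  have "(1 / \<sigma> + 2 * C1 / Lmin) * mean_sq g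
      \<le> c_fun p * (h - h\<^sup>2 / 2 - h * d / 2) * mean_sq g"
    unfolding h_def d_def
    using gradient_gain[OF C(2)] by (intro mult_right_mono mean_sq_nonneg)
  moreover have "11 / 6 * (s / (\<sigma>\<^sup>2 * \<psi>)) * E + 4 * (s / (\<sigma>\<^sup>2 * \<psi>)) * E
      \<le> 6 * (s / (\<sigma>\<^sup>2 * \<psi>)) * E"
  proof -
    have *: "11 / 6 * t * E + 4 * t * E \<le> 6 * t * E" if "0 \<le> t" for t
      using mult_nonneg_nonneg[OF that E0] by (simp add: mult_ac)
    show ?thesis using s psi by (intro *) auto
  qed
  moreover have "(\<Sum>i<n. q i * ((norm (v_next i v y g))\<^sup>2 + C1 * (norm (y_next i v y g - y))\<^sup>2
      + c_fun p * f (x_next i y g)))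
    = (\<Sum>i<n. q i * (norm (v_next i v y g))\<^sup>2)
      + C1 * (\<Sum>i<n. q i * (norm (y_next i v y g - y))\<^sup>2)
      + c_fun p * (\<Sum>i<n. q i * f (x_next i y g))"
    by (simp add: sum.distrib sum_distrib_left algebra_simps)
  moreover have "(1 / \<sigma> + 2 * C1 / Lmin) * mean_sq g
      = mean_sq g / \<sigma> + 2 * C1 / Lmin * mean_sq g"
    by (simp add: distrib_right)
  ultimately show ?thesis
    using drift_of_v[OF y stale'] Y F
    unfolding mean_v_next E_def[symmetric] Z_def[symmetric] by linarith
qed


section \<open>The asynchronicity error\<close>

abbreviation "increment_sq y k j \<equiv> (norm (y (k + 1 - j) - y (k - j)))\<^sup>2"

lemma c_async_eq:
  assumes "0 < \<tau>"
  shows "c_async p i = 6 * (s / (\<sigma>\<^sup>2 * \<psi>)) * (L\<^sup>2 * real \<tau>)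
    * (\<Sum>j=i..\<tau>. (1 - s) powi (int i - int j - 1))"
proof -
  have psi: "\<psi> \<noteq> 0" using assms psi_eq_0_iff by simp
  have kap: "0 < kappa p" using grad_lip_pos sigma_pos by (simp add: kappa_def)
  have "kappa p powr (3/2) = kappa p * sqrt (kappa p)"
    using kap powr_add[of "kappa p" 1 "1/2"] by (simp add: powr_half_sqrt)
  then have kap32: "kappa p powr (3/2) = L / \<sigma> * (sqrt L / sqrt \<sigma>)"
    by (simp add: kappa_def real_sqrt_divide)
  have "6 / S * sqrt L * kappa p powr (3/2) * real \<tau> / \<psi>
      = 6 * (s / (\<sigma>\<^sup>2 * \<psi>)) * (L\<^sup>2 * real \<tau>)"
    unfolding kap32 using grad_lip_pos sigma_pos S_pos psi
    by (simp add: inv_cond_def field_simps power2_eq_square)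
  then show ?thesis by (simp add: c_async_def inv_cond_def)
qed

lemma inv_cond_less_1:
  assumes "0 < \<tau>"
  shows "s < 1" "real \<tau> * s \<le> 1 / 441"
proof -
  have tau: "1 \<le> real \<tau>" using assms by simp
  then have "real \<tau> * 1 \<le> real \<tau> * real \<tau>" by (intro mult_left_mono) auto
  then have "real \<tau> * s \<le> (real \<tau>)\<^sup>2 * s" "1 * s \<le> real \<tau> * s"
    using inv_cond_pos tau by (intro mult_right_mono; simp add: power2_eq_square)+
  then show "s < 1" "real \<tau> * s \<le> 1 / 441"
    using inv_cond_small(2)[OF assms] by auto
qed

lemma c_async_nonneg: "0 \<le> c_async p i"
proof (cases "\<tau> = 0")
  case False
  then have tau: "0 < \<tau>" by simp
  show ?thesis
    unfolding c_async_eq[OF tau]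
    using inv_cond_pos psi_nonneg inv_cond_less_1[OF tau]
    by (intro mult_nonneg_nonneg sum_nonneg) auto
qed (simp add: c_async_def)

text \<open>Multiplication by \<open>1 - s\<close> shifts the geometric sum by one place, up to its first summand
  \<open>1\<close>.\<close>

lemma c_async_recurrence:
  assumes i: "i \<le> \<tau>" and tau: "0 < \<tau>"
  shows "(1 - s) * c_async p i - c_async p (Suc i) = 6 * (s / (\<sigma>\<^sup>2 * \<psi>)) * (L\<^sup>2 * real \<tau>)"
proof -
  have s: "1 - s \<noteq> 0" using inv_cond_less_1[OF tau] by simp
  have "(1 - s) * (\<Sum>j=i..\<tau>. (1 - s) powi (int i - int j - 1))
      = (\<Sum>j=i..\<tau>. (1 - s) powi (int i - int j))"
    unfolding sum_distrib_left
  proof (intro sum.cong refl)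
    fix j
    show "(1 - s) * (1 - s) powi (int i - int j - 1) = (1 - s) powi (int i - int j)"
      using power_int_add_1'[of "1 - s" "int i - int j - 1"] s by simp
  qed
  also have "\<dots> = 1 + (\<Sum>j=Suc i..\<tau>. (1 - s) powi (int (Suc i) - int j - 1))"
    using i by (simp add: sum.atLeast_Suc_atMost)
  finally have "(1 - s) * (\<Sum>j=i..\<tau>. (1 - s) powi (int i - int j - 1))
      - (\<Sum>j=Suc i..\<tau>. (1 - s) powi (int (Suc i) - int j - 1)) = 1"
    by linarith
  then have "6 * (s / (\<sigma>\<^sup>2 * \<psi>)) * (L\<^sup>2 * real \<tau>)
        * ((1 - s) * (\<Sum>j=i..\<tau>. (1 - s) powi (int i - int j - 1))
      - (\<Sum>j=Suc i..\<tau>. (1 - s) powi (int (Suc i) - int j - 1)))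
      = 6 * (s / (\<sigma>\<^sup>2 * \<psi>)) * (L\<^sup>2 * real \<tau>)"
    by (simp only: mult_1_right)
  then show ?thesis
    unfolding c_async_eq[OF tau] by (simp only: right_diff_distrib mult_ac)
qed

text \<open>All summands of \<open>c\<^sub>1\<close> are close to \<open>1\<close>, since \<open>\<tau> s \<le> 1/441\<close>, so \<open>c\<^sub>1\<close> is essentially
  \<open>6 s L\<^sup>2 \<tau>\<^sup>2 / (\<sigma>\<^sup>2 \<psi>)\<close>, and \<open>L\<^sup>2 \<tau>\<^sup>2\<close> is a multiple of \<open>\<psi>\<^sup>2\<close>. The remaining constant
  \<open>6/81 \<cdot> 441/440\<close> is slightly smaller than \<open>1/13\<close>.\<close>

lemma c_async_1_le: "c_async p 1 \<le> \<psi> * Lmin / (13 * \<sigma>)"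
proof (cases "\<tau> = 0")
  case True
  then show ?thesis
    using psi_nonneg[of p] min_lip_pos sigma_pos by (simp add: c_async_def)
next
  case False
  then have tau: "0 < \<tau>" by simp
  have psi: "0 < \<psi>" using tau psi_eq_0_iff psi_nonneg[of p] by linarith
  have s: "0 < s" "s < 1" "real \<tau> * s \<le> 1 / 441"
    using inv_cond_pos inv_cond_less_1[OF tau] by auto
  have "(1 - s) powi (int 1 - int j - 1) \<le> 441 / 440" if "j \<in> {1..\<tau>}" for j
  proof -
    have "real j * s \<le> real \<tau> * s" using that s by (intro mult_right_mono) auto
    moreover have "1 - real j * s \<le> (1 - s) ^ j"
      using s Bernoulli_inequality[of "- s" j] by simp
    ultimately have "440 / 441 \<le> (1 - s) ^ j" using s by linarith
    then have "inverse ((1 - s) ^ j) \<le> inverse (440 / 441)"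
      by (intro le_imp_inverse_le) auto
    then show ?thesis using s by (simp add: power_int_minus)
  qed
  then have "(\<Sum>j=1..\<tau>. (1 - s) powi (int 1 - int j - 1)) \<le> real (card {1..\<tau>}) * (441 / 440)"
    by (intro sum_bounded_above) auto
  then have "c_async p 1 \<le> 6 * (s / (\<sigma>\<^sup>2 * \<psi>)) * (L\<^sup>2 * real \<tau>) * (real \<tau> * (441 / 440))"
    unfolding c_async_eq[OF tau] using s psi by (intro mult_left_mono) auto
  also have "\<dots> = 6 * 441 / (440 * 81) * (s / (\<sigma>\<^sup>2 * \<psi>)) * (81 * L\<^sup>2 * (real \<tau>)\<^sup>2)"
    by (simp add: power2_eq_square)
  also have "\<dots> = 6 * 441 / (440 * 81) * (\<psi> * Lmin / \<sigma>) * (S * s * sqrt \<sigma> / \<sigma>)"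
    using psi sigma_pos unfolding psi_sq[symmetric] by (simp add: power2_eq_square mult_ac)
  also have "S * s * sqrt \<sigma> / \<sigma> = 1"
    using S_pos sigma_pos by (simp add: inv_cond_def)
  also have "6 * 441 / (440 * 81) * (\<psi> * Lmin / \<sigma>) * 1 \<le> 1 / 13 * (\<psi> * Lmin / \<sigma>)"
    unfolding mult_1_right using psi min_lip_pos sigma_pos by (intro mult_right_mono) auto
  finally show ?thesis by simp
qed

text \<open>The sum defining \<open>c\<^sub>i\<close> is empty for \<open>i = \<tau> + 1\<close>, so the increment that leaves the window may be
  kept in the sum with coefficient \<open>0\<close>.\<close>

lemma async_err_Suc:
  "async_err p y (Suc k) = c_async p 1 * (norm (y (Suc k) - y k))\<^sup>2
     + (\<Sum>j=1..\<tau>. c_async p (Suc j) * increment_sq y k j)"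
proof -
  let ?g = "\<lambda>j. c_async p j * increment_sq y (Suc k) j"
  have "async_err p y (Suc k) = (\<Sum>j=1..Suc \<tau>. ?g j)"
    by (simp add: async_err_def c_async_def)
  also have "\<dots> = ?g 1 + (\<Sum>j=Suc 1..Suc \<tau>. ?g j)"
    by (simp add: sum.atLeast_Suc_atMost)
  also have "(\<Sum>j=Suc 1..Suc \<tau>. ?g j) = (\<Sum>j=1..\<tau>. ?g (Suc j))"
    by (rule sum.shift_bounds_cl_Suc_ivl)
  finally show ?thesis by simp
qed

text \<open>Every coordinate has its own delay. A coordinate of the gap is a telescoping sum of at most \<open>\<tau>\<close>
  increments, to which the Cauchy-Schwarz inequality applies; extending the sum to all \<open>\<tau>\<close>
  increments removes the dependence on the coordinate.\<close>

lemma delay_gap: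
  fixes y :: "nat \<Rightarrow> real ^ 'd"
  assumes "\<And>i. i < n \<Longrightarrow> d k i \<le> \<tau>"
  shows "(norm (y k - delayed blk d y k))\<^sup>2 \<le> real \<tau> * (\<Sum>j=1..\<tau>. increment_sq y k j)"
proof -
  have comp: "((y k - delayed blk d y k) $ a)\<^sup>2
      \<le> real \<tau> * (\<Sum>j=1..\<tau>. ((y (k + 1 - j) - y (k - j)) $ a)\<^sup>2)" for a
  proof -
    define m where "m = d k (blk a)"
    have m: "m \<le> \<tau>" using assms[of "blk a"] blocks by (auto simp: m_def)
    have "y k $ a - y (k - m') $ a = (\<Sum>j=1..m'. (y (k + 1 - j) - y (k - j)) $ a)" for m'
      by (induction m') auto
    then have "((y k - delayed blk d y k) $ a)\<^sup>2
        = (\<Sum>j=1..m. (y (k + 1 - j) - y (k - j)) $ a)\<^sup>2"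
      by (simp add: delayed_def m_def)
    also have "\<dots> \<le> (\<Sum>j=1..m. ((y (k + 1 - j) - y (k - j)) $ a)\<^sup>2) * card {1..m}"
      by (rule sum_squared_le_sum_of_squares)
    also have "\<dots> \<le> (\<Sum>j=1..\<tau>. ((y (k + 1 - j) - y (k - j)) $ a)\<^sup>2) * real \<tau>"
      using m by (intro mult_mono sum_mono2 sum_nonneg) auto
    finally show ?thesis by (simp add: mult.commute)
  qed
  have nsq: "(norm u)\<^sup>2 = (\<Sum>a\<in>UNIV. (u $ a)\<^sup>2)" for u :: "real ^ 'd"
    unfolding power2_norm_eq_inner inner_vec_def by (simp add: power2_eq_square)
  have "(norm (y k - delayed blk d y k))\<^sup>2
      \<le> (\<Sum>a\<in>UNIV. real \<tau> * (\<Sum>j=1..\<tau>. ((y (k + 1 - j) - y (k - j)) $ a)\<^sup>2))"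
    unfolding nsq[of "y k - delayed blk d y k"] by (intro sum_mono comp)
  also have "\<dots> = real \<tau> * (\<Sum>j=1..\<tau>. increment_sq y k j)"
    unfolding sum_distrib_left[symmetric] nsq by (subst sum.swap) simp
  finally show ?thesis .
qed

lemma async_err_absorbs_staleness:
  fixes y :: "nat \<Rightarrow> real ^ 'd"
  assumes "\<And>i. i < n \<Longrightarrow> d k i \<le> \<tau>"
  shows "6 * (s / (\<sigma>\<^sup>2 * \<psi>)) * (norm (grad (y k) - grad (delayed blk d y k)))\<^sup>2
      + (\<Sum>j=1..\<tau>. c_async p (Suc j) * increment_sq y k j)
    \<le> beta p * async_err p y k"
proof (cases "\<tau> = 0")
  case True
  then show ?thesis using psi_eq_0_iff by (simp add: async_err_def)
next
  case False
  then have tau: "0 < \<tau>" by simp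
  let ?C = "6 * (s / (\<sigma>\<^sup>2 * \<psi>))"
  have C: "0 \<le> ?C" using inv_cond_pos psi_nonneg by simp
  have "norm (grad (y k) - grad (delayed blk d y k)) \<le> L * norm (y k - delayed blk d y k)"
    using lipschitz_onD[OF gradient_lipschitz, of "y k" "delayed blk d y k"]
    by (simp add: dist_norm)
  then have "(norm (grad (y k) - grad (delayed blk d y k)))\<^sup>2
      \<le> (L * norm (y k - delayed blk d y k))\<^sup>2"
    by (intro power_mono) auto
  also have "\<dots> = L\<^sup>2 * (norm (y k - delayed blk d y k))\<^sup>2"
    by (rule power_mult_distrib)
  also have "\<dots> \<le> L\<^sup>2 * (real \<tau> * (\<Sum>j=1..\<tau>. increment_sq y k j))"
    by (intro mult_left_mono delay_gap assms) auto
  finally have "?C * (norm (grad (y k) - grad (delayed blk d y k)))\<^sup>2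
      \<le> ?C * (L\<^sup>2 * (real \<tau> * (\<Sum>j=1..\<tau>. increment_sq y k j)))"
    using C by (rule mult_left_mono)
  also have "\<dots> = (\<Sum>j=1..\<tau>. ?C * (L\<^sup>2 * real \<tau>) * increment_sq y k j)"
    by (simp add: sum_distrib_left mult_ac)
  finally have "?C * (norm (grad (y k) - grad (delayed blk d y k)))\<^sup>2
      + (\<Sum>j=1..\<tau>. c_async p (Suc j) * increment_sq y k j)
      \<le> (\<Sum>j=1..\<tau>. (?C * (L\<^sup>2 * real \<tau>) + c_async p (Suc j)) * increment_sq y k j)"
    by (simp add: distrib_right sum.distrib)
  also have "\<dots> \<le> (\<Sum>j=1..\<tau>. beta p * c_async p j * increment_sq y k j)"
  proof (intro sum_mono mult_right_mono)
    fix j assume "j \<in> {1..\<tau>}"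
    then have "?C * (L\<^sup>2 * real \<tau>) + c_async p (Suc j) = (1 - s) * c_async p j"
      using c_async_recurrence[OF _ tau, of j] by simp
    also have "\<dots> \<le> beta p * c_async p j"
      using psi_nonneg[of p] inv_cond_pos unfolding beta_eq
      by (intro mult_right_mono c_async_nonneg) (simp add: mult_left_le_one_le algebra_simps)
    finally show "?C * (L\<^sup>2 * real \<tau>) + c_async p (Suc j) \<le> beta p * c_async p j" .
  qed simp
  also have "\<dots> = beta p * async_err p y k"
    by (simp add: async_err_def sum_distrib_left mult.assoc)
  finally show ?thesis .
qed

text \<open>The contraction for one iteration, with the sequence \<open>y\<close> overwritten at \<open>k + 1\<close> by the value
  that results from updating block \<open>i\<close>.\<close>

lemma one_step_error_mean:
  fixes y :: "nat \<Rightarrow> real ^ 'd"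
  assumes y: "y k = alpha p *\<^sub>R v + (1 - alpha p) *\<^sub>R x"
    and d: "\<And>i. i < n \<Longrightarrow> d k i \<le> \<tau>"
  defines "g \<equiv> grad (delayed blk d y k)"
  shows "(\<Sum>i<n. q i * ((norm (v_next i v (y k) g))\<^sup>2
      + async_err p (y(Suc k := y_next i v (y k) g)) (Suc k) + c_fun p * f (x_next i (y k) g)))
    \<le> beta p * ((norm v)\<^sup>2 + async_err p y k + c_fun p * f x)"
proof -
  define T where "T = (\<Sum>j=1..\<tau>. c_async p (Suc j) * increment_sq y k j)"
  have A: "async_err p (y(Suc k := z)) (Suc k) = c_async p 1 * (norm (z - y k))\<^sup>2 + T" for z
    unfolding async_err_Suc T_def by (intro arg_cong2[of _ _ _ _ "(+)"] sum.cong) auto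
  have "\<tau> = 0 \<Longrightarrow> delayed blk d y k = y k"
  proof -
    assume "\<tau> = 0"
    moreover have "blk a < n" for a using blocks by auto
    ultimately show "delayed blk d y k = y k"
      using d by (simp add: delayed_def vec_eq_iff)
  qed
  then have stale: "\<tau> = 0 \<Longrightarrow> g = grad (y k)" by (simp add: g_def)
  have "(\<Sum>i<n. q i * ((norm (v_next i v (y k) g))\<^sup>2
      + async_err p (y(Suc k := y_next i v (y k) g)) (Suc k) + c_fun p * f (x_next i (y k) g)))
    = (\<Sum>i<n. q i * ((norm (v_next i v (y k) g))\<^sup>2
      + c_async p 1 * (norm (y_next i v (y k) g - y k))\<^sup>2 + c_fun p * f (x_next i (y k) g)))
      + (\<Sum>i<n. q i) * T"
    unfolding A sum_distrib_right sum.distrib[symmetric]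
    by (intro sum.cong refl) (simp add: algebra_simps)
  also have "\<dots> \<le> beta p * ((norm v)\<^sup>2 + c_fun p * f x)
      + 6 * (s / (\<sigma>\<^sup>2 * \<psi>)) * (norm (grad (y k) - g))\<^sup>2 + (\<Sum>i<n. q i) * T"
    using one_step_mean[OF y stale c_async_nonneg c_async_1_le] by simp
  also have "\<dots> \<le> beta p * ((norm v)\<^sup>2 + c_fun p * f x) + beta p * async_err p y k"
    using async_err_absorbs_staleness[of d k y, OF d]
    by (simp add: sum_blk_prob T_def g_def)
  finally show ?thesis by (simp add: algebra_simps)
qed

end


section \<open>Independent random choices\<close>

lemma Int_stable_preimages: "Int_stable {f -` B \<inter> \<Omega> | B. True}"
proof (rule Int_stableI)
  fix a b assume "a \<in> {f -` B \<inter> \<Omega> | B. True}" "b \<in> {f -` B \<inter> \<Omega> | B. True}"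
  then obtain B C where "a = f -` B \<inter> \<Omega>" "b = f -` C \<inter> \<Omega>" by auto
  then have "a \<inter> b = f -` (B \<inter> C) \<inter> \<Omega>" by auto
  then show "a \<inter> b \<in> {f -` B \<inter> \<Omega> | B. True}" by (intro CollectI exI conjI TrueI)
qed

context prob_space
begin

lemma indep_set_mono: "indep_set A B \<Longrightarrow> A' \<subseteq> A \<Longrightarrow> B' \<subseteq> B \<Longrightarrow> indep_set A' B'"
  unfolding indep_sets2_eq by (meson subset_iff)

text \<open>The events generated by the extra information and by the earlier choices form a
  \<open>\<sigma>\<close>-algebra that is generated by the intersections of one event of each kind. These
  intersections are stable under intersection, and the product rule holds for them because the
  extra information is independent of all choices together and the choices are independent of each
  other.\<close>

lemma indep_set_extra_and_earlier:
  fixes J :: "nat \<Rightarrow> 'a \<Rightarrow> nat"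
  assumes indep: "indep_vars (\<lambda>_. count_space UNIV) J UNIV"
    and extra: "indep_set (sigma_sets (space M) \<D>)
      (sigma_sets (space M) {J m -` B \<inter> space M | m B. True})"
    and gen: "\<G> \<subseteq> \<D> \<union> {J m -` B \<inter> space M | m B. m < k}"
  shows "indep_set (sigma_sets (space M) \<G>) {J k -` B \<inter> space M | B. True}"
proof -
  let ?\<sigma> = "sigma_sets (space M)"
  let ?gen = "\<lambda>m. {J m -` B \<inter> space M | B. True}"
  let ?past = "\<Union>m\<in>{..<k}. ?gen m"
  let ?all = "{J m -` B \<inter> space M | m B. True}"
  define \<P> where "\<P> = {a \<inter> b | a b. a \<in> ?\<sigma> \<D> \<and> b \<in> ?\<sigma> ?past}"
  have P_I: "a \<inter> b \<in> \<P>" if "a \<in> ?\<sigma> \<D>" "b \<in> ?\<sigma> ?past" for a b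
    unfolding \<P>_def using that by blast
  have Dev: "?\<sigma> \<D> \<subseteq> events" and Jev: "?\<sigma> ?all \<subseteq> events"
    and prod: "\<And>a b. a \<in> ?\<sigma> \<D> \<Longrightarrow> b \<in> ?\<sigma> ?all \<Longrightarrow> prob (a \<inter> b) = prob a * prob b"
    using extra unfolding indep_sets2_eq by auto
  have past_all: "?\<sigma> ?past \<subseteq> ?\<sigma> ?all" by (rule sigma_sets_mono') blast
  have gen_all: "?gen m \<subseteq> ?\<sigma> ?all" for m by (auto intro: sigma_sets.Basic)
  have Dpow: "\<D> \<subseteq> Pow (space M)"
    using Dev sets.sets_into_space by (blast intro: sigma_sets.Basic)
  have all_pow: "?all \<subseteq> Pow (space M)" and past_pow: "?past \<subseteq> Pow (space M)" by auto
  interpret DA: sigma_algebra "space M" "?\<sigma> \<D>" by (rule sigma_algebra_sigma_sets[OF Dpow])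
  interpret AA: sigma_algebra "space M" "?\<sigma> ?all" by (rule sigma_algebra_sigma_sets[OF all_pow])
  interpret PA: sigma_algebra "space M" "?\<sigma> ?past" by (rule sigma_algebra_sigma_sets[OF past_pow])

  have pair: "indep_sets (\<lambda>j. ?\<sigma> (\<Union>i\<in>(if j then {..<k} else {k}). ?gen i)) (UNIV :: bool set)"
  proof (rule indep_sets_collect_sigma)
    have "indep_sets (\<lambda>m. {J m -` B \<inter> space M | B. B \<in> sets (count_space UNIV)}) UNIV"
      using indep unfolding indep_vars_def2 by blast
    then have "indep_sets ?gen UNIV" by (simp only: sets_count_space Pow_UNIV UNIV_I)
    then show "indep_sets ?gen (\<Union>j\<in>UNIV. if j then {..<k} else {k})"
      by (rule indep_sets_mono_index[rotated]) simp
    show "Int_stable (?gen i)" for i by (rule Int_stable_preimages)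
    show "disjoint_family_on (\<lambda>j. if j then {..<k} else {k}) (UNIV :: bool set)"
      by (auto simp: disjoint_family_on_def)
  qed
  have split: "prob (b \<inter> c) = prob b * prob c" if "b \<in> ?\<sigma> ?past" "c \<in> ?gen k" for b c
  proof -
    have "c \<in> ?\<sigma> (\<Union>i\<in>{k}. ?gen i)"
      by (rule sigma_sets.Basic, rule UN_I[of k], rule singletonI, rule that(2))
    then have mem: "(if j then b else c) \<in> ?\<sigma> (\<Union>i\<in>(if j then {..<k} else {k}). ?gen i)" for j
      using that(1) by (cases j) (simp_all only: if_True if_False)
    have "prob (\<Inter>j\<in>UNIV. if j then b else c) = (\<Prod>j\<in>UNIV. prob (if j then b else c))"
      by (rule indep_setsD[OF pair subset_UNIV UNIV_not_empty finite ballI]) (rule mem)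
    then show ?thesis by (simp add: UNIV_bool Int_commute mult.commute)
  qed

  have "indep_set \<P> (?gen k)"
    unfolding indep_sets2_eq
  proof (intro conjI ballI)
    show "\<P> \<subseteq> events" using Dev Jev past_all unfolding \<P>_def by blast
    show "?gen k \<subseteq> events" using Jev gen_all by blast
    fix e c assume "e \<in> \<P>" and c: "c \<in> ?gen k"
    then obtain a b where e: "e = a \<inter> b" and a: "a \<in> ?\<sigma> \<D>" and b: "b \<in> ?\<sigma> ?past"
      unfolding \<P>_def by blast
    have b': "b \<in> ?\<sigma> ?all" and c': "c \<in> ?\<sigma> ?all" using b c past_all gen_all by blast+
    have "prob (e \<inter> c) = prob (a \<inter> (b \<inter> c))" by (simp add: e Int_assoc)
    also have "\<dots> = prob a * (prob b * prob c)"
      using prod[OF a AA.Int[OF b' c']] split[OF b c] by simp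
    also have "\<dots> = prob e * prob c" using prod[OF a b'] by (simp add: e)
    finally show "prob (e \<inter> c) = prob e * prob c" .
  qed
  then have "indep_set (?\<sigma> \<P>) (?\<sigma> (?gen k))"
  proof (rule indep_set_sigma_sets)
    show "Int_stable \<P>"
    proof (rule Int_stableI)
      fix e e' assume "e \<in> \<P>" "e' \<in> \<P>"
      then obtain a b a' b' where "e = a \<inter> b" "e' = a' \<inter> b'"
        and "a \<in> ?\<sigma> \<D>" "a' \<in> ?\<sigma> \<D>" "b \<in> ?\<sigma> ?past" "b' \<in> ?\<sigma> ?past"
        unfolding \<P>_def by blast
      then have "(a \<inter> a') \<inter> (b \<inter> b') \<in> \<P>"
        by (intro P_I DA.Int PA.Int)
      moreover have "e \<inter> e' = (a \<inter> a') \<inter> (b \<inter> b')"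
        unfolding \<open>e = a \<inter> b\<close> \<open>e' = a' \<inter> b'\<close> by (simp only: Int_ac)
      ultimately show "e \<inter> e' \<in> \<P>" by (simp only:)
    qed
    show "Int_stable (?gen k)" by (rule Int_stable_preimages)
  qed
  moreover have "?\<sigma> \<G> \<subseteq> ?\<sigma> \<P>"
  proof (rule sigma_sets_mono)
    show "\<G> \<subseteq> ?\<sigma> \<P>"
    proof
      fix a assume "a \<in> \<G>"
      with gen consider "a \<in> \<D>" | "a \<in> ?past" by blast
      then have "a \<in> \<P>"
      proof cases
        case 1
        then have "a \<inter> space M \<in> \<P>" by (intro P_I PA.top sigma_sets.Basic)
        moreover have "a \<inter> space M = a"
          by (rule Int_absorb2, rule PowD, rule subsetD[OF Dpow 1])
        ultimately show ?thesis by (simp only:)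
      next
        case 2
        then have "space M \<inter> a \<in> \<P>" by (intro P_I DA.top sigma_sets.Basic)
        moreover have "space M \<inter> a = a"
          by (rule Int_absorb1, rule PowD, rule subsetD[OF past_pow 2])
        ultimately show ?thesis by (simp only:)
      qed
      then show "a \<in> ?\<sigma> \<P>" by (rule sigma_sets.Basic)
    qed
  qed
  moreover have "?gen k \<subseteq> ?\<sigma> (?gen k)" by (rule sigma_sets_superset_generator)
  ultimately show ?thesis by (rule indep_set_mono)
qed

lemma expectation_on_indep_choice:
  fixes J :: "'a \<Rightarrow> nat" and g :: "'a \<Rightarrow> real"
  assumes indep: "indep_set (sets G) {J -` B \<inter> space M | B. True}"
    and G: "subalgebra M G"
    and g: "g \<in> borel_measurable G" "integrable M g"
  shows "(\<integral>\<omega>. indicator {j} (J \<omega>) * g \<omega> \<partial>M) = prob {\<omega> \<in> space M. J \<omega> = j} * (\<integral>\<omega>. g \<omega> \<partial>M)"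
    and "integrable M (\<lambda>\<omega>. indicator {j} (J \<omega>) * g \<omega>)"
proof -
  let ?i = "\<lambda>\<omega>. indicator {j} (J \<omega>) :: real"
  have Jev: "J -` B \<inter> space M \<in> events" for B using indep unfolding indep_sets2_eq by blast
  have J: "J \<in> measurable M (count_space UNIV)" by (rule measurableI) (use Jev in auto)
  have Gspace: "space G = space M" using G by (simp add: subalgebra_def)
  let ?A = "vimage_algebra (space M) J (count_space UNIV :: nat measure)"
  have Asets: "sets ?A = {J -` B \<inter> space M | B. True}"
    by (simp add: sets_vimage_algebra2)
  have iA: "?i \<in> borel_measurable ?A"
    using measurable_compose[OF measurable_vimage_algebra1, of J "space M" "count_space UNIV"
        "indicator {j}" borel] by simp
  have "indep_var borel g borel ?i"
    unfolding indep_var_eq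
  proof (intro conjI)
    show "random_variable borel g" by (rule measurable_from_subalg[OF G g(1)])
    show "random_variable borel ?i"
      using measurable_compose[OF J, of "indicator {j}" borel] by simp
    show "indep_set (sigma_sets (space M) {g -` A \<inter> space M | A. A \<in> sets borel})
        (sigma_sets (space M) {?i -` A \<inter> space M | A. A \<in> sets borel})"
    proof (rule indep_set_mono[OF indep])
      have "{g -` A \<inter> space M | A. A \<in> sets borel} \<subseteq> sets G"
        using measurable_sets[OF g(1)] by (auto simp: Gspace)
      then show "sigma_sets (space M) {g -` A \<inter> space M | A. A \<in> sets borel} \<subseteq> sets G"
        using sets.sigma_sets_subset[of _ G] by (simp add: Gspace)
      have "{?i -` A \<inter> space M | A. A \<in> sets borel} \<subseteq> sets ?A"
        using measurable_sets[OF iA] by auto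
      then show "sigma_sets (space M) {?i -` A \<inter> space M | A. A \<in> sets borel}
          \<subseteq> {J -` B \<inter> space M | B. True}"
        unfolding Asets[symmetric] using sets.sigma_sets_subset[of _ ?A] by simp
    qed
  qed
  moreover have int_i: "integrable M ?i"
    using measurable_compose[OF J, of "indicator {j}" borel]
    by (intro integrable_const_bound[where B=1]) (auto simp: indicator_def)
  moreover have "(\<integral>\<omega>. ?i \<omega> \<partial>M) = prob {\<omega> \<in> space M. J \<omega> = j}"
  proof -
    have "(\<integral>\<omega>. ?i \<omega> \<partial>M) = (\<integral>\<omega>. indicator {\<omega> \<in> space M. J \<omega> = j} \<omega> \<partial>M)"
      by (intro Bochner_Integration.integral_cong) (auto simp: indicator_def)
    also have "\<dots> = prob {\<omega> \<in> space M. J \<omega> = j}"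
      by (simp add: Int_absorb2)
    finally show ?thesis .
  qed
  ultimately show "(\<integral>\<omega>. ?i \<omega> * g \<omega> \<partial>M) = prob {\<omega> \<in> space M. J \<omega> = j} * (\<integral>\<omega>. g \<omega> \<partial>M)"
    and "integrable M (\<lambda>\<omega>. ?i \<omega> * g \<omega>)"
    using indep_var_lebesgue_integral[OF _ g(2) int_i] indep_var_integrable[OF _ g(2) int_i]
    by (simp_all add: mult.commute)
qed

lemma set_integral_indep_choice:
  fixes J :: "'a \<Rightarrow> nat" and g :: "nat \<Rightarrow> 'a \<Rightarrow> real"
  assumes indep: "indep_set (sets G) {J -` B \<inter> space M | B. True}"
    and G: "subalgebra M G"
    and distr: "\<And>i. i < n \<Longrightarrow> prob {\<omega> \<in> space M. J \<omega> = i} = q i" "(\<Sum>i<n. q i) = 1"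
    and g: "\<And>i. i < n \<Longrightarrow> g i \<in> borel_measurable G" "\<And>i. i < n \<Longrightarrow> integrable M (g i)"
    and Y: "integrable M (\<lambda>\<omega>. g (J \<omega>) \<omega>)"
    and A: "A \<in> sets G"
  shows "(\<integral>\<omega>\<in>A. g (J \<omega>) \<omega> \<partial>M) = (\<integral>\<omega>\<in>A. (\<Sum>i<n. q i * g i \<omega>) \<partial>M)"
proof -
  have AM: "A \<in> events" using A G by (auto simp: subalgebra_def)
  have Jev: "J -` B \<inter> space M \<in> events" for B using indep unfolding indep_sets2_eq by blast
  have J [measurable]: "J \<in> measurable M (count_space UNIV)" by (rule measurableI) (use Jev in auto)
  have "prob (J -` {..<n} \<inter> space M) = prob (\<Union>i<n. {\<omega> \<in> space M. J \<omega> = i})"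
    by (intro arg_cong[of _ _ prob]) auto
  also have "\<dots> = (\<Sum>i<n. prob {\<omega> \<in> space M. J \<omega> = i})"
    by (intro finite_measure_finite_Union) (auto simp: disjoint_family_on_def)
  also have "\<dots> = 1" using distr by simp
  finally have AE: "AE \<omega> in M. J \<omega> < n"
    by (rule AE_mp[OF AE_prob_1]) auto
  let ?h = "\<lambda>i \<omega>. indicator A \<omega> * g i \<omega>"
  have h: "?h i \<in> borel_measurable G" "integrable M (?h i)" if "i < n" for i
    using g[OF that] A integrable_mult_indicator[OF AM g(2)[OF that]] by auto
  have "(\<integral>\<omega>\<in>A. g (J \<omega>) \<omega> \<partial>M) = (\<integral>\<omega>. (\<Sum>i<n. indicator {i} (J \<omega>) * ?h i \<omega>) \<partial>M)"
    unfolding set_lebesgue_integral_def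
  proof (rule integral_cong_AE)
    show "(\<lambda>\<omega>. indicator A \<omega> *\<^sub>R g (J \<omega>) \<omega>) \<in> borel_measurable M"
      using Y AM by measurable
    show "(\<lambda>\<omega>. \<Sum>i<n. indicator {i} (J \<omega>) * ?h i \<omega>) \<in> borel_measurable M"
      using expectation_on_indep_choice(2)[OF indep G h]
      by (intro borel_measurable_sum) auto
    show "AE \<omega> in M. indicator A \<omega> *\<^sub>R g (J \<omega>) \<omega> = (\<Sum>i<n. indicator {i} (J \<omega>) * ?h i \<omega>)"
      using AE
    proof eventually_elim
      case (elim \<omega>)
      have "(\<Sum>i<n. indicator {i} (J \<omega>) * ?h i \<omega>) = (\<Sum>i<n. if i = J \<omega> then ?h i \<omega> else 0)"
        by (intro sum.cong) (auto simp: indicator_def)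
      then show ?case using elim by simp
    qed
  qed
  also have "\<dots> = (\<Sum>i<n. \<integral>\<omega>. indicator {i} (J \<omega>) * ?h i \<omega> \<partial>M)"
    using expectation_on_indep_choice(2)[OF indep G h] by (intro Bochner_Integration.integral_sum) auto
  also have "\<dots> = (\<Sum>i<n. q i * (\<integral>\<omega>. ?h i \<omega> \<partial>M))"
    using expectation_on_indep_choice(1)[OF indep G h] distr by (intro sum.cong) auto
  also have "\<dots> = (\<integral>\<omega>. (\<Sum>i<n. q i * ?h i \<omega>) \<partial>M)"
    using h by (subst Bochner_Integration.integral_sum) auto
  also have "\<dots> = (\<integral>\<omega>\<in>A. (\<Sum>i<n. q i * g i \<omega>) \<partial>M)"
    unfolding set_lebesgue_integral_def by (simp add: sum_distrib_left mult_ac)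
  finally show ?thesis .
qed

text \<open>A random function \<open>g\<^sub>J\<close> whose index \<open>J\<close> is independent of the information \<open>G\<close> may be replaced
  by its mean over \<open>J\<close> when integrating over events of \<open>G\<close>. The mean is measurable for
  \<open>G\<close> only, whereas the bound \<open>Z\<close> is measurable for the smaller \<open>H\<close>; conditioning on \<open>H\<close> therefore
  keeps the bound.\<close>

lemma real_cond_exp_indep_choice_le:
  fixes J :: "'a \<Rightarrow> nat" and g :: "nat \<Rightarrow> 'a \<Rightarrow> real"
  assumes indep: "indep_set (sets G) {J -` B \<inter> space M | B. True}"
    and G: "subalgebra M G" and H: "subalgebra M H" "sets H \<subseteq> sets G"
    and distr: "\<And>i. i < n \<Longrightarrow> prob {\<omega> \<in> space M. J \<omega> = i} = q i" "(\<Sum>i<n. q i) = 1"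
    and g: "\<And>i. i < n \<Longrightarrow> g i \<in> borel_measurable G" "\<And>i. i < n \<Longrightarrow> integrable M (g i)"
    and Y: "integrable M (\<lambda>\<omega>. g (J \<omega>) \<omega>)"
    and Z: "Z \<in> borel_measurable H" "integrable M Z"
    and le: "\<And>\<omega>. \<omega> \<in> space M \<Longrightarrow> (\<Sum>i<n. q i * g i \<omega>) \<le> Z \<omega>"
  shows "AE \<omega> in M. real_cond_exp M H (\<lambda>\<omega>. g (J \<omega>) \<omega>) \<omega> \<le> Z \<omega>"
    and "(\<integral>\<omega>. g (J \<omega>) \<omega> \<partial>M) \<le> (\<integral>\<omega>. Z \<omega> \<partial>M)"
proof -
  interpret finite_measure_subalgebra M H by unfold_locales (rule H)
  let ?m = "\<lambda>\<omega>. \<Sum>i<n. q i * g i \<omega>"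
  have m: "integrable M ?m" using g by auto
  have "AE \<omega> in M. real_cond_exp M H (\<lambda>\<omega>. g (J \<omega>) \<omega>) \<omega> = real_cond_exp M H ?m \<omega>"
  proof (rule real_cond_exp_charact)
    fix A assume A: "A \<in> sets H"
    then have "(\<integral>\<omega>\<in>A. g (J \<omega>) \<omega> \<partial>M) = (\<integral>\<omega>\<in>A. ?m \<omega> \<partial>M)"
      using H(2) by (intro set_integral_indep_choice[OF indep G distr g Y]) auto
    also have "\<dots> = (\<integral>\<omega>\<in>A. real_cond_exp M H ?m \<omega> \<partial>M)"
      by (rule real_cond_exp_intA[OF m A])
    finally show "(\<integral>\<omega>\<in>A. g (J \<omega>) \<omega> \<partial>M) = (\<integral>\<omega>\<in>A. real_cond_exp M H ?m \<omega> \<partial>M)" .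
  qed (use Y m real_cond_exp_int in auto)
  moreover have "AE \<omega> in M. real_cond_exp M H ?m \<omega> \<le> real_cond_exp M H Z \<omega>"
    using le m Z by (intro real_cond_exp_mono) auto
  moreover have "AE \<omega> in M. real_cond_exp M H Z \<omega> = Z \<omega>"
    using Z by (intro real_cond_exp_F_meas)
  ultimately show "AE \<omega> in M. real_cond_exp M H (\<lambda>\<omega>. g (J \<omega>) \<omega>) \<omega> \<le> Z \<omega>"
    by eventually_elim simp
  have sp: "space M \<in> sets G" using G by (metis sets.top subalgebra_def)
  have "(\<integral>\<omega>. g (J \<omega>) \<omega> \<partial>M) = (\<integral>\<omega>\<in>space M. g (J \<omega>) \<omega> \<partial>M)"
    by (rule set_integral_space[OF Y, symmetric])
  also have "\<dots> = (\<integral>\<omega>\<in>space M. ?m \<omega> \<partial>M)"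
    by (rule set_integral_indep_choice[OF indep G distr g Y sp])
  also have "\<dots> = (\<integral>\<omega>. ?m \<omega> \<partial>M)" by (rule set_integral_space[OF m])
  also have "\<dots> \<le> (\<integral>\<omega>. Z \<omega> \<partial>M)" using le m Z by (intro integral_mono) auto
  finally show "(\<integral>\<omega>. g (J \<omega>) \<omega> \<partial>M) \<le> (\<integral>\<omega>. Z \<omega> \<partial>M)" .
qed

end


section \<open>Iteration complexity\<close>

text \<open>For \<open>\<rho> = 1\<close> the logarithm takes its default value and carries no information; then \<open>0 < K\<close>
  is what makes the power vanish.\<close>

lemma power_le_of_iteration_complexity_le:
  assumes "0 < \<rho>" "\<rho> \<le> 1" "0 < \<epsilon>" "0 < K" "iteration_complexity \<rho> \<epsilon> \<le> real K"
  shows "(1 - \<rho>) ^ K \<le> \<epsilon>"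
proof (cases "\<rho> = 1")
  case True
  then show ?thesis using assms by (simp add: power_0_left)
next
  case False
  then have r: "0 < 1 - \<rho>" "1 - \<rho> < 1" using assms by auto
  then have pos: "0 < - ln (1 - \<rho>)" by simp
  have "ln (1 / \<epsilon>) \<le> real K * - ln (1 - \<rho>)"
    using assms(5) pos_divide_le_eq[OF pos] unfolding iteration_complexity_def by blast
  then have "ln ((1 - \<rho>) ^ K) \<le> ln \<epsilon>"
    using assms(3) r by (simp add: ln_realpow ln_div)
  then show ?thesis
    using assms(3) r by simp
qed

text \<open>Inverses of the elementary bounds \<open>\<rho> \<le> - ln (1 - \<rho>) \<le> \<rho> / (1 - \<rho>)\<close>.\<close>

lemma inverse_neg_ln_bounds:
  fixes \<rho> :: real
  assumes "0 < \<rho>" "\<rho> < 1"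
  shows "1 / \<rho> - 1 \<le> 1 / - ln (1 - \<rho>)" "1 / - ln (1 - \<rho>) \<le> 1 / \<rho>"
proof -
  have lower: "\<rho> \<le> - ln (1 - \<rho>)"
    using ln_le_minus_one[of "1 - \<rho>"] assms by simp
  then show "1 / - ln (1 - \<rho>) \<le> 1 / \<rho>"
    using assms by (intro divide_left_mono mult_pos_pos) auto
  have "- ln (1 - \<rho>) = ln (1 / (1 - \<rho>))" using assms by (simp add: ln_div)
  also have "\<dots> \<le> 1 / (1 - \<rho>) - 1" using assms by (intro ln_le_minus_one) simp
  also have "\<dots> = \<rho> / (1 - \<rho>)" using assms by (simp add: field_simps)
  finally have "1 / (\<rho> / (1 - \<rho>)) \<le> 1 / - ln (1 - \<rho>)"
    using assms lower by (intro divide_left_mono mult_pos_pos divide_pos_pos) auto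
  then show "1 / \<rho> - 1 \<le> 1 / - ln (1 - \<rho>)"
    using assms by (simp add: diff_divide_distrib)
qed

lemma K_A2BCD_asymptotics:
  "\<exists>R. R \<in> O[cond_at_top](\<lambda>_. 1 :: real) \<and>
     (\<forall>q\<in>admissible_params. \<forall>\<epsilon>\<in>{0<..<1}.
        K_A2BCD q \<epsilon> = ((\<Sum>i<num_blocks q. sqrt (blk_lip q i / str_cvx q)) + R q)
                        * (ln (1 / \<epsilon>) / (1 - psi q)))"
proof -
  define rate where "rate q = (1 - psi q) * sqrt (str_cvx q) / S_sum q" for q
  define R where "R q = (1 - psi q) * (1 / - ln (1 - rate q))
      - (\<Sum>i<num_blocks q. sqrt (blk_lip q i / str_cvx q))" for q
  have bound: "\<bar>R q\<bar> \<le> 1"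
    if adm: "q \<in> admissible_params" and large: "2 \<le> S_sum q / sqrt (str_cvx q)" for q
  proof -
    have psi: "0 \<le> psi q" "psi q \<le> 3/7" and sig: "0 < str_cvx q"
      using adm by (auto simp: admissible_params_def psi_def)
    have S: "0 < S_sum q"
      using large sig by (smt (verit) divide_nonpos_nonneg real_sqrt_ge_zero)
    have rate_pos: "0 < rate q" using psi sig S by (simp add: rate_def)
    have "2 * sqrt (str_cvx q) \<le> S_sum q"
      using large sig by (simp add: le_divide_eq)
    moreover have "(1 - psi q) * sqrt (str_cvx q) \<le> 1 * sqrt (str_cvx q)"
      using psi sig by (intro mult_right_mono) auto
    ultimately have "(1 - psi q) * sqrt (str_cvx q) < S_sum q"
      using real_sqrt_gt_zero[OF sig] by linarith
    then have rate_less: "rate q < 1"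
      using S by (simp add: rate_def)
    have "(\<Sum>i<num_blocks q. sqrt (blk_lip q i / str_cvx q)) = S_sum q / sqrt (str_cvx q)"
      by (simp add: S_sum_def real_sqrt_divide sum_divide_distrib)
    also have "\<dots> = (1 - psi q) * (1 / rate q)"
      using psi sig S by (simp add: rate_def)
    finally have R: "R q = (1 - psi q) * (1 / - ln (1 - rate q) - 1 / rate q)"
      by (simp add: R_def right_diff_distrib)
    have "\<bar>1 / - ln (1 - rate q) - 1 / rate q\<bar> \<le> 1"
      using inverse_neg_ln_bounds[OF rate_pos rate_less] by linarith
    then have "\<bar>1 - psi q\<bar> * \<bar>1 / - ln (1 - rate q) - 1 / rate q\<bar> \<le> 1 * 1"
      using psi by (intro mult_mono) auto
    then show ?thesis by (simp add: R abs_mult)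
  qed
  have "\<forall>\<^sub>F q in cond_at_top. norm (R q) \<le> 1 * norm (1 :: real)"
    unfolding cond_at_top_def eventually_inf_principal
    using eventually_filtercomapI[OF eventually_ge_at_top[of "2::real"]]
    by (rule eventually_mono) (use bound in auto)
  then have "R \<in> O[cond_at_top](\<lambda>_. 1 :: real)"
    by (rule bigoI)
  moreover have "K_A2BCD q \<epsilon> = ((\<Sum>i<num_blocks q. sqrt (blk_lip q i / str_cvx q)) + R q)
      * (ln (1 / \<epsilon>) / (1 - psi q))" if "q \<in> admissible_params" for q \<epsilon>
  proof -
    have "1 - psi q \<noteq> 0" using that by (auto simp: admissible_params_def)
    then show ?thesis
      by (simp add: K_A2BCD_def iteration_complexity_def R_def rate_def)
  qed
  ultimately show ?thesis by blast
qed


section \<open>The random iterates\<close>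

lemma bounded_continuous_comp:
  fixes h :: "'b::heine_borel \<Rightarrow> 'c::metric_space"
  assumes "continuous_on UNIV h" "bounded (g ` A)"
  shows "bounded ((\<lambda>\<omega>. h (g \<omega>)) ` A)"
proof -
  have "compact (closure (g ` A))" using assms(2) by simp
  then have "compact (h ` closure (g ` A))"
    using assms(1) continuous_on_subset by (intro compact_continuous_image) auto
  then have "bounded (h ` closure (g ` A))" by (rule compact_imp_bounded)
  then show ?thesis
    by (rule bounded_subset) (use closure_subset[of "g ` A"] in auto)
qed

lemma bounded_const_comp: "bounded ((\<lambda>_. c) ` A)"
  by (rule bounded_subset[of "{c}"]) auto

lemma bounded_norm_sq:
  fixes g :: "'a \<Rightarrow> 'b::{real_normed_vector, heine_borel}"
  assumes "bounded (g ` A)"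
  shows "bounded ((\<lambda>\<omega>. (norm (g \<omega>))\<^sup>2) ` A)"
  by (rule bounded_continuous_comp[where h="\<lambda>u. (norm u)\<^sup>2", OF _ assms]) (intro continuous_intros)

lemma bounded_cmult: "bounded (g ` A) \<Longrightarrow> bounded ((\<lambda>\<omega>. r * g \<omega>) ` A)"
  for g :: "'a \<Rightarrow> real"
  using bounded_scaleR_comp[of g A r] by simp

lemma bounded_sum_comp:
  fixes g :: "'i \<Rightarrow> 'a \<Rightarrow> 'b::real_normed_vector"
  assumes "\<And>j. j \<in> J \<Longrightarrow> bounded (g j ` A)"
  shows "bounded ((\<lambda>\<omega>. \<Sum>j\<in>J. g j \<omega>) ` A)"
  using assms
proof (induction J rule: infinite_finite_induct)
  case (insert j J)
  then show ?case by (simp add: bounded_plus_comp)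
qed (simp_all add: bounded_const_comp)

locale a2bcd_process = a2bcd_objective p f grad blk + prob_space M
  for p :: a2bcd_params
    and f :: "real ^ 'd \<Rightarrow> real"
    and grad :: "real ^ 'd \<Rightarrow> real ^ 'd"
    and blk :: "'d::finite \<Rightarrow> nat"
    and M :: "'w measure" +
  fixes I :: "nat \<Rightarrow> 'w \<Rightarrow> nat"
    and D :: "nat \<Rightarrow> nat \<Rightarrow> 'w \<Rightarrow> nat"
    and x y v :: "nat \<Rightarrow> 'w \<Rightarrow> real ^ 'd"
    and x0 v0 :: "real ^ 'd"
  assumes indices_indep: "indep_vars (\<lambda>_. count_space UNIV) I UNIV"
    and indices_distr: "\<And>k j. j < num_blocks p \<Longrightarrow>
      prob {\<omega> \<in> space M. I k \<omega> = j} = sqrt (blk_lip p j) / S_sum p"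
    and delays_bounded: "\<And>k i \<omega>. i < num_blocks p \<Longrightarrow> \<omega> \<in> space M \<Longrightarrow> D k i \<omega> \<le> max_delay p"
    and delays_indep: "indep_set
      (sigma_sets (space M) {D k i -` B \<inter> space M | k i B. i < num_blocks p})
      (sigma_sets (space M) {I k -` B \<inter> space M | k B. True})"
    and x_init: "\<And>\<omega>. \<omega> \<in> space M \<Longrightarrow> x 0 \<omega> = x0"
    and v_init: "\<And>\<omega>. \<omega> \<in> space M \<Longrightarrow> v 0 \<omega> = v0"
    and y_step: "\<And>k \<omega>. \<omega> \<in> space M \<Longrightarrow>
      y k \<omega> = alpha p *\<^sub>R v k \<omega> + (1 - alpha p) *\<^sub>R x k \<omega>"
    and x_step: "\<And>k \<omega>. \<omega> \<in> space M \<Longrightarrow>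
      x (Suc k) \<omega> = y k \<omega> - (step_h p / blk_lip p (I k \<omega>)) *\<^sub>R
        blk_proj blk (I k \<omega>) (grad (delayed blk (\<lambda>m i. D m i \<omega>) (\<lambda>m. y m \<omega>) k))"
    and v_step: "\<And>k \<omega>. \<omega> \<in> space M \<Longrightarrow>
      v (Suc k) \<omega> = beta p *\<^sub>R v k \<omega> + (1 - beta p) *\<^sub>R y k \<omega>
        - (1 / (sqrt (str_cvx p) * sqrt (blk_lip p (I k \<omega>)))) *\<^sub>R
          blk_proj blk (I k \<omega>) (grad (delayed blk (\<lambda>m i. D m i \<omega>) (\<lambda>m. y m \<omega>) k))"
begin

definition stale_grad :: "nat \<Rightarrow> 'w \<Rightarrow> real ^ 'd" where
  "stale_grad k \<omega> = grad (delayed blk (\<lambda>m i. D m i \<omega>) (\<lambda>m. y m \<omega>) k)"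

lemma x_Suc: "\<omega> \<in> space M \<Longrightarrow> x (Suc k) \<omega> = x_next (I k \<omega>) (y k \<omega>) (stale_grad k \<omega>)"
  by (simp add: x_step x_next_def stale_grad_def)

lemma v_Suc: "\<omega> \<in> space M \<Longrightarrow> v (Suc k) \<omega> = v_next (I k \<omega>) (v k \<omega>) (y k \<omega>) (stale_grad k \<omega>)"
  by (simp add: v_step v_next_def stale_grad_def)

lemma y_Suc: "\<omega> \<in> space M \<Longrightarrow> y (Suc k) \<omega> = y_next (I k \<omega>) (v k \<omega>) (y k \<omega>) (stale_grad k \<omega>)"
  by (simp add: y_step[of _ "Suc k"] x_Suc v_Suc y_next_def)

lemma continuous_f: "continuous_on UNIV f"
  unfolding continuous_on_eq_continuous_at[OF open_UNIV]
  using gradient has_derivative_continuous unfolding gderiv_def by blast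

lemma continuous_grad: "continuous_on UNIV grad"
  by (rule lipschitz_on_continuous_on[OF gradient_lipschitz])

lemma f_measurable [measurable]: "f \<in> borel_measurable borel"
  by (rule borel_measurable_continuous_onI[OF continuous_f])

lemma grad_measurable [measurable]: "grad \<in> borel_measurable borel"
  by (rule borel_measurable_continuous_onI[OF continuous_grad])

subsection \<open>Measurability with respect to the past\<close>

text \<open>What determines the stale gradient and the iterates up to time \<open>k\<close>: all delays, including future
  ones, and the earlier block indices. This is more than the history, which does not see the
  delays.\<close>

definition past :: "nat \<Rightarrow> 'w measure" where
  "past k = sigma (space M) ({D m i -` B \<inter> space M | m i B. i < n}
     \<union> {I m -` B \<inter> space M | m B. m < k})"

lemma space_past [simp]: "space (past k) = space M"
  by (simp add: past_def space_measure_of_conv)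

lemma sets_past: "sets (past k) = sigma_sets (space M)
    ({D m i -` B \<inter> space M | m i B. i < n} \<union> {I m -` B \<inter> space M | m B. m < k})"
  unfolding past_def by (rule sets_measure_of) auto

lemma past_mono: "k \<le> l \<Longrightarrow> sets (past k) \<subseteq> sets (past l)"
  unfolding sets_past
  by (intro sigma_sets_mono' Un_mono subset_refl Collect_mono impI)
    (elim exE conjE, intro exI conjI, assumption, erule less_le_trans, assumption)

lemma past_measurable_mono: "g \<in> borel_measurable (past k) \<Longrightarrow> k \<le> l \<Longrightarrow> g \<in> borel_measurable (past l)"
  using past_mono[of k l] by (auto simp: measurable_def)

lemma indep_past: "indep_set (sets (past k)) {I k -` B \<inter> space M | B. True}"
  unfolding sets_past
  by (rule indep_set_extra_and_earlier[OF indices_indep delays_indep subset_refl])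

lemma subalgebra_past: "subalgebra M (past k)"
  using indep_past[of k] unfolding subalgebra_def indep_sets2_eq by simp

lemma delay_measurable_past: "i < n \<Longrightarrow> D m i \<in> measurable (past k) (count_space UNIV)"
  by (rule measurableI) (simp, unfold sets_past space_past, rule sigma_sets.Basic, rule UnI1,
    rule CollectI, intro exI conjI, rule refl, assumption)

lemma index_measurable_past: "m < k \<Longrightarrow> I m \<in> measurable (past k) (count_space UNIV)"
  by (rule measurableI) (simp, unfold sets_past space_past, rule sigma_sets.Basic, rule UnI2,
    rule CollectI, intro exI conjI, rule refl, assumption)

lemma delayed_measurable_past:
  assumes "\<And>m. m \<le> k \<Longrightarrow> y m \<in> borel_measurable (past l)"
  shows "(\<lambda>\<omega>. delayed blk (\<lambda>m i. D m i \<omega>) (\<lambda>m. y m \<omega>) k) \<in> borel_measurable (past l)"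
proof (subst borel_measurable_euclidean_space, rule ballI)
  fix b :: "real ^ 'd" assume "b \<in> Basis"
  then obtain a where b: "b = axis a 1" by (auto simp: Basis_vec_def)
  have "blk a < n" using blocks by auto
  then have D: "D k (blk a) \<in> measurable (past l) (count_space UNIV)"
    by (rule delay_measurable_past)
  have "(\<lambda>\<omega>. y (k - D k (blk a) \<omega>) \<omega>) \<in> borel_measurable (past l)"
    by (rule measurable_compose_countable[where f="\<lambda>m \<omega>. y (k - m) \<omega>", OF _ D])
      (simp add: assms)
  then have "(\<lambda>\<omega>. y (k - D k (blk a) \<omega>) \<omega> \<bullet> b) \<in> borel_measurable (past l)"
    by (rule borel_measurable_inner[OF _ borel_measurable_const])
  then show "(\<lambda>\<omega>. delayed blk (\<lambda>m i. D m i \<omega>) (\<lambda>m. y m \<omega>) k \<bullet> b) \<in> borel_measurable (past l)"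
    by (simp add: b inner_axis delayed_def)
qed

lemma x_next_measurable:
  "Y \<in> borel_measurable N \<Longrightarrow> G \<in> borel_measurable N \<Longrightarrow>
    (\<lambda>\<omega>. x_next i (Y \<omega>) (G \<omega>)) \<in> borel_measurable N"
  unfolding x_next_def
  by (rule borel_measurable_diff[OF _ borel_measurable_scaleR[OF borel_measurable_const
        measurable_compose[OF _ blk_proj_measurable]]])

lemma v_next_measurable:
  "V \<in> borel_measurable N \<Longrightarrow> Y \<in> borel_measurable N \<Longrightarrow> G \<in> borel_measurable N \<Longrightarrow>
    (\<lambda>\<omega>. v_next i (V \<omega>) (Y \<omega>) (G \<omega>)) \<in> borel_measurable N"
  unfolding v_next_def
  by (rule borel_measurable_diff[OF
        borel_measurable_add[OF borel_measurable_scaleR[OF borel_measurable_const]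
          borel_measurable_scaleR[OF borel_measurable_const]]
        borel_measurable_scaleR[OF borel_measurable_const
          measurable_compose[OF _ blk_proj_measurable]]])

lemma y_next_measurable:
  "V \<in> borel_measurable N \<Longrightarrow> Y \<in> borel_measurable N \<Longrightarrow> G \<in> borel_measurable N \<Longrightarrow>
    (\<lambda>\<omega>. y_next i (V \<omega>) (Y \<omega>) (G \<omega>)) \<in> borel_measurable N"
  unfolding y_next_def
  by (rule borel_measurable_add[OF
        borel_measurable_scaleR[OF borel_measurable_const v_next_measurable]
        borel_measurable_scaleR[OF borel_measurable_const x_next_measurable]])

lemma iterates_measurable_past_all:
  "m \<le> k \<Longrightarrow> x m \<in> borel_measurable (past k) \<and> v m \<in> borel_measurable (past k)
    \<and> y m \<in> borel_measurable (past k)"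
proof (induction k arbitrary: m)
  have y: "y m \<in> borel_measurable (past k)"
    if "x m \<in> borel_measurable (past k)" "v m \<in> borel_measurable (past k)" for m k
    using that by (subst measurable_cong[OF y_step]) auto
  {
    case 0
    have "x 0 \<in> borel_measurable (past 0)"
      by (subst measurable_cong[of _ _ "\<lambda>_. x0"]) (auto simp: x_init)
    moreover have "v 0 \<in> borel_measurable (past 0)"
      by (subst measurable_cong[of _ _ "\<lambda>_. v0"]) (auto simp: v_init)
    ultimately show ?case using 0 y by simp
  next
    case (Suc k)
    have old: "x m \<in> borel_measurable (past (Suc k))" "v m \<in> borel_measurable (past (Suc k))"
      "y m \<in> borel_measurable (past (Suc k))" if "m \<le> k" for m
      using Suc.IH[OF that] past_measurable_mono[of _ k "Suc k"] by auto
    have G: "stale_grad k \<in> borel_measurable (past (Suc k))"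
      unfolding stale_grad_def[abs_def]
      by (intro measurable_compose[OF delayed_measurable_past grad_measurable] old)
    have I: "I k \<in> measurable (past (Suc k)) (count_space UNIV)"
      by (rule index_measurable_past) simp
    have "(\<lambda>\<omega>. x_next (I k \<omega>) (y k \<omega>) (stale_grad k \<omega>)) \<in> borel_measurable (past (Suc k))"
      by (rule measurable_compose_countable
          [where f="\<lambda>i \<omega>. x_next i (y k \<omega>) (stale_grad k \<omega>)", OF _ I])
        (intro x_next_measurable old G order_refl)
    then have newx: "x (Suc k) \<in> borel_measurable (past (Suc k))"
      by (subst measurable_cong[OF x_Suc]) auto
    have "(\<lambda>\<omega>. v_next (I k \<omega>) (v k \<omega>) (y k \<omega>) (stale_grad k \<omega>))
        \<in> borel_measurable (past (Suc k))"
      by (rule measurable_compose_countable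
          [where f="\<lambda>i \<omega>. v_next i (v k \<omega>) (y k \<omega>) (stale_grad k \<omega>)", OF _ I])
        (intro v_next_measurable old G order_refl)
    then have newv: "v (Suc k) \<in> borel_measurable (past (Suc k))"
      by (subst measurable_cong[OF v_Suc]) auto
    show ?case
      using Suc.prems newx newv y[OF newx newv] old[of m] by (auto simp: le_Suc_eq)
  }
qed

lemma iterates_measurable_past:
  assumes "m \<le> k"
  shows "x m \<in> borel_measurable (past k)" "v m \<in> borel_measurable (past k)"
    "y m \<in> borel_measurable (past k)"
  using iterates_measurable_past_all[OF assms] by auto

lemma stale_grad_measurable_past: "stale_grad k \<in> borel_measurable (past k)"
  unfolding stale_grad_def[abs_def]
  by (intro measurable_compose[OF delayed_measurable_past grad_measurable] iterates_measurable_past)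

subsection \<open>The history\<close>

lemma history_sets: "sets (history M x y v I k) = sigma_sets (space M)
     ({u m -` B \<inter> space M | u m B. u \<in> {x, y, v} \<and> m \<le> k \<and> B \<in> sets borel}
      \<union> {I m -` B \<inter> space M | m B. m < k})"
  unfolding history_def by (rule sets_measure_of) auto

lemma space_history [simp]: "space (history M x y v I k) = space M"
  by (simp add: history_def space_measure_of_conv)

lemma history_subset_past: "sets (history M x y v I k) \<subseteq> sets (past k)"
  unfolding history_sets space_past[of k, symmetric]
proof (rule sets.sigma_sets_subset, safe)
  fix u m B assume m: "m \<le> k" and B: "B \<in> sets (borel :: (real ^ 'd) measure)"
  show "x m -` B \<inter> space (past k) \<in> sets (past k)"
    by (rule measurable_sets[OF iterates_measurable_past(1)[OF m] B])
  show "y m -` B \<inter> space (past k) \<in> sets (past k)"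
    by (rule measurable_sets[OF iterates_measurable_past(3)[OF m] B])
  show "v m -` B \<inter> space (past k) \<in> sets (past k)"
    by (rule measurable_sets[OF iterates_measurable_past(2)[OF m] B])
next
  fix m B assume "m < k"
  then show "I m -` B \<inter> space (past k) \<in> sets (past k)"
    by (intro measurable_sets[OF index_measurable_past]) auto
qed

lemma subalgebra_history: "subalgebra M (history M x y v I k)"
  using history_subset_past subalgebra_past[of k] unfolding subalgebra_def by auto

lemma iterates_measurable_history:
  assumes "u \<in> {x, y, v}" "m \<le> k"
  shows "u m \<in> borel_measurable (history M x y v I k)"
proof (rule measurableI)
  fix B :: "(real ^ 'd) set" assume B: "B \<in> sets borel"
  have "u m -` B \<inter> space M
      \<in> {u m -` B \<inter> space M | u m B. u \<in> {x, y, v} \<and> m \<le> k \<and> B \<in> sets borel}"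
    by (rule CollectI, rule exI[of _ u], rule exI[of _ m], rule exI[of _ B],
        rule conjI, rule refl, rule conjI, rule assms(1), rule conjI, rule assms(2), rule B)
  then show "u m -` B \<inter> space (history M x y v I k) \<in> sets (history M x y v I k)"
    unfolding history_sets space_history by (rule sigma_sets.Basic[OF UnI1])
qed simp

lemma a2bcd_error_measurable_history:
  "a2bcd_error p f x y v k \<in> borel_measurable (history M x y v I k)"
proof -
  have [measurable]: "x k \<in> borel_measurable (history M x y v I k)"
    "v k \<in> borel_measurable (history M x y v I k)"
    by (simp_all add: iterates_measurable_history)
  have "(\<lambda>\<omega>. async_err p (\<lambda>m. y m \<omega>) k) \<in> borel_measurable (history M x y v I k)"
    unfolding async_err_def
  proof (rule borel_measurable_sum)
    fix j assume "j \<in> {1..\<tau>}"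
    then have [measurable]: "y (k + 1 - j) \<in> borel_measurable (history M x y v I k)"
      "y (k - j) \<in> borel_measurable (history M x y v I k)"
      using iterates_measurable_history[of y "k + 1 - j" k]
        iterates_measurable_history[of y "k - j" k] by auto
    show "(\<lambda>\<omega>. c_async p j * (norm (y (k + 1 - j) \<omega> - y (k - j) \<omega>))\<^sup>2)
        \<in> borel_measurable (history M x y v I k)"
      by measurable
  qed
  then show ?thesis unfolding a2bcd_error_def[abs_def] by measurable
qed

subsection \<open>Boundedness\<close>

text \<open>Only finitely many iterates can enter the delayed vector, whatever the delays are.\<close>

lemma bounded_delayed:
  assumes "\<And>m. m \<le> k \<Longrightarrow> bounded (y m ` space M)"
  shows "bounded ((\<lambda>\<omega>. delayed blk (\<lambda>m i. D m i \<omega>) (\<lambda>m. y m \<omega>) k) ` space M)"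
proof -
  have "\<forall>m\<in>{..k}. \<exists>B. \<forall>\<omega>\<in>space M. norm (y m \<omega>) \<le> B"
    using assms by (auto simp: bounded_iff)
  then obtain B where B: "\<And>m \<omega>. m \<le> k \<Longrightarrow> \<omega> \<in> space M \<Longrightarrow> norm (y m \<omega>) \<le> B m"
    by (metis atMost_iff)
  have "norm (delayed blk (\<lambda>m i. D m i \<omega>) (\<lambda>m. y m \<omega>) k) \<le> (\<Sum>a\<in>(UNIV::'d set). \<Sum>m\<le>k. B m)"
    if w: "\<omega> \<in> space M" for \<omega>
  proof -
    have B0: "0 \<le> B m" if "m \<le> k" for m
      using B[OF that w] norm_ge_zero order_trans by blast
    have "\<bar>y (k - D k (blk a) \<omega>) \<omega> $ a\<bar> \<le> (\<Sum>m\<le>k. B m)" for a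
    proof -
      have "\<bar>y (k - D k (blk a) \<omega>) \<omega> $ a\<bar> \<le> norm (y (k - D k (blk a) \<omega>) \<omega>)"
        by (rule component_le_norm_cart)
      also have "\<dots> \<le> B (k - D k (blk a) \<omega>)" by (rule B[OF _ w]) simp
      also have "\<dots> \<le> (\<Sum>m\<le>k. B m)" using B0 by (intro member_le_sum) auto
      finally show ?thesis .
    qed
    then have "(\<Sum>a\<in>UNIV. \<bar>delayed blk (\<lambda>m i. D m i \<omega>) (\<lambda>m. y m \<omega>) k $ a\<bar>)
        \<le> (\<Sum>a\<in>(UNIV::'d set). \<Sum>m\<le>k. B m)"
      by (intro sum_mono) (simp add: delayed_def)
    then show ?thesis using norm_le_l1_cart order_trans by blast
  qed
  then show ?thesis by (auto intro: boundedI)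
qed

text \<open>Block numbers outside the range occur with probability \<open>0\<close> but are possible values of the index;
  they all act alike, namely by an empty block.\<close>

lemma bounded_choice:
  assumes "\<And>i. i \<le> n \<Longrightarrow> bounded (g i ` space M)" and "\<And>i. n \<le> i \<Longrightarrow> g i = g n"
  shows "bounded ((\<lambda>\<omega>. g (I k \<omega>) \<omega>) ` space M)"
proof (rule bounded_subset)
  show "bounded (\<Union>i\<in>{..n}. g i ` space M)" using assms(1) by auto
  have "g i \<omega> \<in> (\<Union>i\<in>{..n}. g i ` space M)" if "\<omega> \<in> space M" for i \<omega>
    using that assms(2)[of i] by (cases "i \<le> n") auto
  then show "(\<lambda>\<omega>. g (I k \<omega>) \<omega>) ` space M \<subseteq> (\<Union>i\<in>{..n}. g i ` space M)" by blast
qed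

lemma blk_proj_no_block:
  assumes "n \<le> i"
  shows "blk_proj blk i u = 0"
proof -
  have "blk a \<noteq> i" for a
    using assms blocks by (metis lessThan_iff not_less rangeI)
  then show ?thesis by (simp add: blk_proj_def vec_eq_iff)
qed

lemma bounded_blk_proj:
  assumes "bounded (g ` A)"
  shows "bounded ((\<lambda>\<omega>. blk_proj blk i (g \<omega>)) ` A)"
proof -
  obtain B where B: "\<And>\<omega>. \<omega> \<in> A \<Longrightarrow> norm (g \<omega>) \<le> B"
    using assms by (auto simp: bounded_iff)
  show ?thesis
    by (rule boundedI[of _ B]) (auto intro: order_trans[OF norm_blk_proj_le B])
qed

lemma bounded_x_next:
  "bounded (Y ` A) \<Longrightarrow> bounded (G ` A) \<Longrightarrow> bounded ((\<lambda>\<omega>. x_next i (Y \<omega>) (G \<omega>)) ` A)"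
  unfolding x_next_def by (intro bounded_minus_comp bounded_scaleR_comp bounded_blk_proj)

lemma bounded_v_next:
  "bounded (V ` A) \<Longrightarrow> bounded (Y ` A) \<Longrightarrow> bounded (G ` A) \<Longrightarrow>
    bounded ((\<lambda>\<omega>. v_next i (V \<omega>) (Y \<omega>) (G \<omega>)) ` A)"
  unfolding v_next_def
  by (intro bounded_minus_comp bounded_plus_comp bounded_scaleR_comp bounded_blk_proj)

lemma bounded_y_next:
  "bounded (V ` A) \<Longrightarrow> bounded (Y ` A) \<Longrightarrow> bounded (G ` A) \<Longrightarrow>
    bounded ((\<lambda>\<omega>. y_next i (V \<omega>) (Y \<omega>) (G \<omega>)) ` A)"
  unfolding y_next_def
  by (intro bounded_plus_comp bounded_scaleR_comp bounded_x_next bounded_v_next)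

text \<open>The starting points are deterministic, and each iteration chooses among finitely many continuous
  maps of finitely many earlier iterates. Boundedness gives all integrability.\<close>

lemma iterates_bounded:
  "bounded (x k ` space M) \<and> bounded (v k ` space M) \<and> bounded (y k ` space M)"
proof (induction k rule: less_induct)
  case (less k)
  have y: "bounded (y k ` space M)" if "bounded (x k ` space M)" "bounded (v k ` space M)"
  proof -
    have "bounded ((\<lambda>\<omega>. alpha p *\<^sub>R v k \<omega> + (1 - alpha p) *\<^sub>R x k \<omega>) ` space M)"
      using that by (intro bounded_plus_comp bounded_scaleR_comp)
    then show ?thesis by (simp add: y_step cong: image_cong)
  qed
  have "bounded (x k ` space M) \<and> bounded (v k ` space M)"
  proof (cases k)
    case 0
    then show ?thesis by (simp add: x_init v_init bounded_const_comp cong: image_cong)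
  next
    case (Suc l)
    have old: "bounded (x m ` space M)" "bounded (v m ` space M)" "bounded (y m ` space M)"
      if "m \<le> l" for m
      using less[of m] that Suc by auto
    have G: "bounded (stale_grad l ` space M)"
      unfolding stale_grad_def[abs_def]
      by (intro bounded_continuous_comp[OF continuous_grad] bounded_delayed old)
    have "bounded ((\<lambda>\<omega>. x_next (I l \<omega>) (y l \<omega>) (stale_grad l \<omega>)) ` space M)"
      by (rule bounded_choice, intro bounded_x_next old G order_refl)
        (simp add: x_next_def blk_proj_no_block)
    moreover have "bounded ((\<lambda>\<omega>. v_next (I l \<omega>) (v l \<omega>) (y l \<omega>) (stale_grad l \<omega>)) ` space M)"
      by (rule bounded_choice, intro bounded_v_next old G order_refl)
        (simp add: v_next_def blk_proj_no_block)
    ultimately show ?thesis by (simp add: Suc x_Suc v_Suc cong: image_cong)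
  qed
  then show ?case using y by blast
qed

lemma stale_grad_bounded: "bounded (stale_grad k ` space M)"
  unfolding stale_grad_def[abs_def] using iterates_bounded
  by (intro bounded_continuous_comp[OF continuous_grad] bounded_delayed) auto

lemma bounded_error:
  fixes V X :: "'w \<Rightarrow> real ^ 'd" and Y :: "nat \<Rightarrow> 'w \<Rightarrow> real ^ 'd"
  assumes "bounded (V ` A)" "bounded (X ` A)" "\<And>m. m \<le> k \<Longrightarrow> bounded (Y m ` A)"
  shows "bounded ((\<lambda>\<omega>. (norm (V \<omega>))\<^sup>2 + async_err p (\<lambda>m. Y m \<omega>) k + c_fun p * f (X \<omega>)) ` A)"
proof -
  have "bounded ((\<lambda>\<omega>. async_err p (\<lambda>m. Y m \<omega>) k) ` A)"
    unfolding async_err_def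
  proof (rule bounded_sum_comp)
    fix j assume "j \<in> {1..\<tau>}"
    then have "bounded (Y (k + 1 - j) ` A)" "bounded (Y (k - j) ` A)"
      using assms(3)[of "k + 1 - j"] assms(3)[of "k - j"] by auto
    then show "bounded ((\<lambda>\<omega>. c_async p j * (norm (Y (k + 1 - j) \<omega> - Y (k - j) \<omega>))\<^sup>2) ` A)"
      by (rule bounded_cmult[OF bounded_norm_sq[OF bounded_minus_comp]])
  qed
  moreover have "bounded ((\<lambda>\<omega>. c_fun p * f (X \<omega>)) ` A)"
    by (rule bounded_cmult[OF bounded_continuous_comp[OF continuous_f assms(2)]])
  ultimately show ?thesis
    by (rule bounded_plus_comp[OF bounded_plus_comp[OF bounded_norm_sq[OF assms(1)]]])
qed

subsection \<open>Linear convergence\<close>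

text \<open>The error at time \<open>k + 1\<close> that results if block \<open>i\<close> is updated in iteration \<open>k\<close>.\<close>

definition error_next :: "nat \<Rightarrow> nat \<Rightarrow> 'w \<Rightarrow> real" where
  "error_next k i \<omega> = (norm (v_next i (v k \<omega>) (y k \<omega>) (stale_grad k \<omega>)))\<^sup>2
     + async_err p ((\<lambda>m. y m \<omega>)(Suc k := y_next i (v k \<omega>) (y k \<omega>) (stale_grad k \<omega>))) (Suc k)
     + c_fun p * f (x_next i (y k \<omega>) (stale_grad k \<omega>))"

lemma a2bcd_error_Suc:
  assumes "\<omega> \<in> space M"
  shows "a2bcd_error p f x y v (Suc k) \<omega> = error_next k (I k \<omega>) \<omega>"
proof -
  have "(\<lambda>m. y m \<omega>)(Suc k := y (Suc k) \<omega>) = (\<lambda>m. y m \<omega>)" by auto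
  then show ?thesis
    unfolding a2bcd_error_def error_next_def
    by (simp only: x_Suc[OF assms] v_Suc[OF assms] y_Suc[OF assms, symmetric])
qed

lemma error_next_measurable: "error_next k i \<in> borel_measurable (past k)"
proof -
  note G = stale_grad_measurable_past[of k]
  have X: "(\<lambda>\<omega>. x_next i (y k \<omega>) (stale_grad k \<omega>)) \<in> borel_measurable (past k)"
    and V: "(\<lambda>\<omega>. v_next i (v k \<omega>) (y k \<omega>) (stale_grad k \<omega>)) \<in> borel_measurable (past k)"
    and Y: "(\<lambda>\<omega>. y_next i (v k \<omega>) (y k \<omega>) (stale_grad k \<omega>)) \<in> borel_measurable (past k)"
    by (intro x_next_measurable v_next_measurable y_next_measurable iterates_measurable_past G
        order_refl)+
  define U where "U m \<omega> = ((\<lambda>m. y m \<omega>)(Suc k := y_next i (v k \<omega>) (y k \<omega>) (stale_grad k \<omega>))) m"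
    for m \<omega>
  have Z: "U m \<in> borel_measurable (past k)" if "m \<le> Suc k" for m
    using that Y iterates_measurable_past(3)[of m k] unfolding U_def[abs_def]
    by (cases "m = Suc k") auto
  have "(\<lambda>\<omega>. async_err p (\<lambda>m. U m \<omega>) (Suc k)) \<in> borel_measurable (past k)"
    unfolding async_err_def
  proof (rule borel_measurable_sum)
    fix j assume "j \<in> {1..\<tau>}"
    then have "U (Suc k + 1 - j) \<in> borel_measurable (past k)" "U (Suc k - j) \<in> borel_measurable (past k)"
      by (auto intro!: Z)
    then show "(\<lambda>\<omega>. c_async p j * (norm (U (Suc k + 1 - j) \<omega> - U (Suc k - j) \<omega>))\<^sup>2)
        \<in> borel_measurable (past k)"
      by (rule borel_measurable_times[OF borel_measurable_const borel_measurable_power[OF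
            measurable_compose[OF borel_measurable_diff borel_measurable_norm]]])
  qed
  then have A: "(\<lambda>\<omega>. async_err p ((\<lambda>m. y m \<omega>)(Suc k := y_next i (v k \<omega>) (y k \<omega>) (stale_grad k \<omega>)))
      (Suc k)) \<in> borel_measurable (past k)"
    unfolding U_def .
  show ?thesis
    unfolding error_next_def[abs_def]
    by (rule borel_measurable_add[OF borel_measurable_add[OF
          borel_measurable_power[OF measurable_compose[OF V borel_measurable_norm]] A]
          borel_measurable_times[OF borel_measurable_const measurable_compose[OF X f_measurable]]])
qed

lemma integrable_bounded_past:
  fixes g :: "'w \<Rightarrow> real"
  assumes "g \<in> borel_measurable (past k)" "bounded (g ` space M)"
  shows "integrable M g"
proof -
  obtain B where "\<And>\<omega>. \<omega> \<in> space M \<Longrightarrow> norm (g \<omega>) \<le> B"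
    using assms(2) by (auto simp: bounded_iff)
  then show ?thesis
    by (intro integrable_const_bound[where B=B] measurable_from_subalg[OF subalgebra_past assms(1)])
      auto
qed

lemma integrable_error_next: "integrable M (error_next k i)"
proof (rule integrable_bounded_past[OF error_next_measurable])
  define U where "U m \<omega> = ((\<lambda>m. y m \<omega>)(Suc k := y_next i (v k \<omega>) (y k \<omega>) (stale_grad k \<omega>))) m"
    for m \<omega>
  have y: "bounded (y m ` space M)" and v: "bounded (v m ` space M)" for m
    using iterates_bounded by auto
  have "bounded (U m ` space M)" for m
    using bounded_y_next[OF v[of k] y[of k] stale_grad_bounded[of k], of i] y[of m]
    unfolding U_def[abs_def] by (cases "m = Suc k") auto
  then have "bounded ((\<lambda>\<omega>. (norm (v_next i (v k \<omega>) (y k \<omega>) (stale_grad k \<omega>)))\<^sup>2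
      + async_err p (\<lambda>m. U m \<omega>) (Suc k)
      + c_fun p * f (x_next i (y k \<omega>) (stale_grad k \<omega>))) ` space M)"
    by (rule bounded_error[OF bounded_v_next[OF v y stale_grad_bounded]
          bounded_x_next[OF y stale_grad_bounded]])
  then show "bounded (error_next k i ` space M)"
    unfolding error_next_def[abs_def] U_def .
qed

lemma integrable_a2bcd_error: "integrable M (a2bcd_error p f x y v k)"
proof (rule integrable_bounded_past)
  have "subalgebra (past k) (history M x y v I k)"
    using history_subset_past by (simp add: subalgebra_def)
  then show "a2bcd_error p f x y v k \<in> borel_measurable (past k)"
    by (rule measurable_from_subalg[OF _ a2bcd_error_measurable_history])
  show "bounded (a2bcd_error p f x y v k ` space M)"
    unfolding a2bcd_error_def[abs_def]
    by (rule bounded_error) (simp_all add: iterates_bounded)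
qed

lemma mean_error_next_le:
  assumes "\<omega> \<in> space M"
  shows "(\<Sum>i<n. q i * error_next k i \<omega>) \<le> beta p * a2bcd_error p f x y v k \<omega>"
  unfolding error_next_def a2bcd_error_def stale_grad_def
  using delays_bounded assms
  by (intro one_step_error_mean[where y="\<lambda>m. y m \<omega>", OF y_step]) auto

lemma error_contraction:
  shows "AE \<omega> in M. real_cond_exp M (history M x y v I k) (a2bcd_error p f x y v (Suc k)) \<omega>
      \<le> beta p * a2bcd_error p f x y v k \<omega>"
    and "(\<integral>\<omega>. a2bcd_error p f x y v (Suc k) \<omega> \<partial>M)
      \<le> beta p * (\<integral>\<omega>. a2bcd_error p f x y v k \<omega> \<partial>M)"
proof -
  let ?H = "history M x y v I k"
  have int: "integrable M (\<lambda>\<omega>. error_next k (I k \<omega>) \<omega>)"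
    using integrable_a2bcd_error[of "Suc k"]
    by (simp add: a2bcd_error_Suc cong: Bochner_Integration.integrable_cong)
  have Z: "(\<lambda>\<omega>. beta p * a2bcd_error p f x y v k \<omega>) \<in> borel_measurable ?H"
    "integrable M (\<lambda>\<omega>. beta p * a2bcd_error p f x y v k \<omega>)"
    using a2bcd_error_measurable_history integrable_a2bcd_error by auto
  have distr: "prob {\<omega> \<in> space M. I k \<omega> = i} = q i" if "i < n" for i
    using indices_distr[OF that] by (simp add: blk_prob_def)
  have le1: "AE \<omega> in M. real_cond_exp M ?H (\<lambda>\<omega>. error_next k (I k \<omega>) \<omega>) \<omega>
      \<le> beta p * a2bcd_error p f x y v k \<omega>"
    by (rule real_cond_exp_indep_choice_le(1)[where J="I k" and g="error_next k",
        OF indep_past subalgebra_past subalgebra_history history_subset_past distr sum_blk_prob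
        error_next_measurable integrable_error_next int Z mean_error_next_le])
  have le2: "(\<integral>\<omega>. error_next k (I k \<omega>) \<omega> \<partial>M)
      \<le> (\<integral>\<omega>. beta p * a2bcd_error p f x y v k \<omega> \<partial>M)"
    by (rule real_cond_exp_indep_choice_le(2)[where J="I k" and g="error_next k",
        OF indep_past subalgebra_past subalgebra_history history_subset_past distr sum_blk_prob
        error_next_measurable integrable_error_next int Z mean_error_next_le])
  interpret H: finite_measure_subalgebra M ?H by unfold_locales (rule subalgebra_history)
  have "AE \<omega> in M. real_cond_exp M ?H (a2bcd_error p f x y v (Suc k)) \<omega>
      = real_cond_exp M ?H (\<lambda>\<omega>. error_next k (I k \<omega>) \<omega>) \<omega>"
    by (rule H.real_cond_exp_cong)
      (use int integrable_a2bcd_error[of "Suc k"] a2bcd_error_Suc in auto)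
  with le1 show "AE \<omega> in M. real_cond_exp M ?H (a2bcd_error p f x y v (Suc k)) \<omega>
      \<le> beta p * a2bcd_error p f x y v k \<omega>"
    by eventually_elim simp
  show "(\<integral>\<omega>. a2bcd_error p f x y v (Suc k) \<omega> \<partial>M)
      \<le> beta p * (\<integral>\<omega>. a2bcd_error p f x y v k \<omega> \<partial>M)"
    using le2 by (simp add: a2bcd_error_Suc cong: Bochner_Integration.integral_cong)
qed

lemma expected_error_le:
  "(\<integral>\<omega>. a2bcd_error p f x y v K \<omega> \<partial>M)
    \<le> beta p ^ K * (\<integral>\<omega>. a2bcd_error p f x y v 0 \<omega> \<partial>M)"
proof (induction K)
  case (Suc K)
  have "(\<integral>\<omega>. a2bcd_error p f x y v (Suc K) \<omega> \<partial>M)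
      \<le> beta p * (\<integral>\<omega>. a2bcd_error p f x y v K \<omega> \<partial>M)"
    by (rule error_contraction(2))
  also have "\<dots> \<le> beta p * (beta p ^ K * (\<integral>\<omega>. a2bcd_error p f x y v 0 \<omega> \<partial>M))"
    using Suc beta_bounds by (intro mult_left_mono) auto
  finally show ?case by (simp add: mult.assoc)
qed simp

lemma a2bcd_error_nonneg: "0 \<le> a2bcd_error p f x y v k \<omega>"
  unfolding a2bcd_error_def async_err_def
  by (intro add_nonneg_nonneg sum_nonneg mult_nonneg_nonneg c_async_nonneg c_fun_nonneg f_nonneg)
    auto

lemma iterations_suffice:
  assumes "0 < \<epsilon>" "0 < K" "K_A2BCD p \<epsilon> \<le> real K"
  shows "(\<integral>\<omega>. a2bcd_error p f x y v K \<omega> \<partial>M) \<le> \<epsilon> * (\<integral>\<omega>. a2bcd_error p f x y v 0 \<omega> \<partial>M)"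
proof -
  have "beta p ^ K \<le> \<epsilon>"
  proof -
    have "0 < (1 - \<psi>) * s" using psi_le inv_cond_pos by simp
    moreover have "(1 - \<psi>) * s \<le> 1" using beta_bounds by (simp add: beta_eq)
    moreover have "iteration_complexity ((1 - \<psi>) * s) \<epsilon> \<le> real K"
      using assms(3) by (simp add: K_A2BCD_def inv_cond_def)
    ultimately show ?thesis
      unfolding beta_eq using assms by (intro power_le_of_iteration_complexity_le)
  qed
  moreover have "0 \<le> (\<integral>\<omega>. a2bcd_error p f x y v 0 \<omega> \<partial>M)"
    by (rule Bochner_Integration.integral_nonneg) (rule a2bcd_error_nonneg)
  ultimately show ?thesis
    using expected_error_le[of K] by (meson mult_right_mono order_trans)
qed

end


theorem theorem1:
  fixes p :: a2bcd_params
    and f :: "real ^ 'd \<Rightarrow> real"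
    and grad :: "real ^ 'd \<Rightarrow> real ^ 'd"
    and blk :: "'d::finite \<Rightarrow> nat"
    and M :: "'w measure"
    and I :: "nat \<Rightarrow> 'w \<Rightarrow> nat"
    and D :: "nat \<Rightarrow> nat \<Rightarrow> 'w \<Rightarrow> nat"
    and x y v :: "nat \<Rightarrow> 'w \<Rightarrow> real ^ 'd"
    and x0 v0 :: "real ^ 'd"
  \<comment> \<open>the objective\<close>
  assumes blocks: "range blk = {..<num_blocks p}"
    and sigma_pos: "0 < str_cvx p"
    and strongly_convex: "strongly_convex (str_cvx p) f"
    and gradient: "\<And>z. GDERIV f z :> grad z"
    and gradient_lipschitz: "(grad_lip p)-lipschitz_on UNIV grad"
    and block_lipschitz: "\<And>i z h. i < num_blocks p \<Longrightarrow>
      norm (blk_proj blk i (grad (z + blk_proj blk i h)) - blk_proj blk i (grad z))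
        \<le> blk_lip p i * norm h"
    \<comment> \<open>automatic if the \<open>L\<^sub>i\<close> are the least block Lipschitz constants\<close>
    and min_lip_le: "min_lip p \<le> grad_lip p"
    and minimizer: "\<And>z. f 0 \<le> f z" and minimum: "f 0 = 0"
    and psi_le: "psi p \<le> 3/7"
  \<comment> \<open>block indices and delays\<close>
    and prob: "prob_space M"
    and indices_indep: "prob_space.indep_vars M (\<lambda>_. count_space UNIV) I UNIV"
    and indices_distr: "\<And>k j. j < num_blocks p \<Longrightarrow>
      measure M {\<omega> \<in> space M. I k \<omega> = j} = sqrt (blk_lip p j) / S_sum p"
    and delays_bounded: "\<And>k i \<omega>. i < num_blocks p \<Longrightarrow> \<omega> \<in> space M \<Longrightarrow> D k i \<omega> \<le> max_delay p"
    and delays_indep: "prob_space.indep_set M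
      (sigma_sets (space M) {D k i -` B \<inter> space M | k i B. i < num_blocks p})
      (sigma_sets (space M) {I k -` B \<inter> space M | k B. True})"
  \<comment> \<open>the iteration\<close>
    and x_init: "\<And>\<omega>. \<omega> \<in> space M \<Longrightarrow> x 0 \<omega> = x0"
    and v_init: "\<And>\<omega>. \<omega> \<in> space M \<Longrightarrow> v 0 \<omega> = v0"
    and y_step: "\<And>k \<omega>. \<omega> \<in> space M \<Longrightarrow>
      y k \<omega> = alpha p *\<^sub>R v k \<omega> + (1 - alpha p) *\<^sub>R x k \<omega>"
    and x_step: "\<And>k \<omega>. \<omega> \<in> space M \<Longrightarrow>
      x (Suc k) \<omega> = y k \<omega> - (step_h p / blk_lip p (I k \<omega>)) *\<^sub>R
        blk_proj blk (I k \<omega>) (grad (delayed blk (\<lambda>m i. D m i \<omega>) (\<lambda>m. y m \<omega>) k))"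
    and v_step: "\<And>k \<omega>. \<omega> \<in> space M \<Longrightarrow>
      v (Suc k) \<omega> = beta p *\<^sub>R v k \<omega> + (1 - beta p) *\<^sub>R y k \<omega>
        - (1 / (sqrt (str_cvx p) * sqrt (blk_lip p (I k \<omega>)))) *\<^sub>R
          blk_proj blk (I k \<omega>) (grad (delayed blk (\<lambda>m i. D m i \<omega>) (\<lambda>m. y m \<omega>) k))"
  \<comment> \<open>The conjuncts: linear convergence, with integrability so that the conditional expectation is
      meaningful; \<open>K_A2BCD p \<epsilon>\<close> iterations suffice (\<open>0 < K\<close> only matters if the rate is 1, where
      \<open>K_A2BCD p \<epsilon> = 0\<close> but one iteration is needed); asymptotics of the complexity, uniformly in
      all parameters and in \<open>\<epsilon>\<close>.\<close>
  shows
    "(\<forall>k. subalgebra M (history M x y v I k)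
       \<and> integrable M (a2bcd_error p f x y v (Suc k))
       \<and> (AE \<omega> in M.
            real_cond_exp M (history M x y v I k) (a2bcd_error p f x y v (Suc k)) \<omega>
              \<le> (1 - (1 - psi p) * sqrt (str_cvx p) / S_sum p) * a2bcd_error p f x y v k \<omega>))
     \<and> (\<forall>\<epsilon>\<in>{0<..<1}. \<forall>K>0. K_A2BCD p \<epsilon> \<le> real K \<longrightarrow>
       (\<integral>\<omega>. a2bcd_error p f x y v K \<omega> \<partial>M) \<le> \<epsilon> * (\<integral>\<omega>. a2bcd_error p f x y v 0 \<omega> \<partial>M))
     \<and> (\<exists>R. R \<in> O[cond_at_top](\<lambda>_. 1 :: real) \<and>
       (\<forall>q\<in>admissible_params. \<forall>\<epsilon>\<in>{0<..<1}.
          K_A2BCD q \<epsilon> = ((\<Sum>i<num_blocks q. sqrt (blk_lip q i / str_cvx q)) + R q)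
                          * (ln (1 / \<epsilon>) / (1 - psi q))))"
proof -
  interpret prob_space M by (rule prob)
  interpret a2bcd_process p f grad blk M I D x y v x0 v0
    by unfold_locales (fact assms)+
  have rate: "beta p = 1 - (1 - psi p) * sqrt (str_cvx p) / S_sum p"
    by (rule beta_def)
  show ?thesis
  proof (intro conjI allI ballI impI)
    fix k
    show "subalgebra M (history M x y v I k)" by (rule subalgebra_history)
    show "integrable M (a2bcd_error p f x y v (Suc k))" by (rule integrable_a2bcd_error)
    show "AE \<omega> in M. real_cond_exp M (history M x y v I k) (a2bcd_error p f x y v (Suc k)) \<omega>
        \<le> (1 - (1 - psi p) * sqrt (str_cvx p) / S_sum p) * a2bcd_error p f x y v k \<omega>"
      using error_contraction(1)[of k] unfolding rate .
  next
    fix \<epsilon> :: real and K :: nat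
    assume "\<epsilon> \<in> {0<..<1}" "0 < K" "K_A2BCD p \<epsilon> \<le> real K"
    then show "(\<integral>\<omega>. a2bcd_error p f x y v K \<omega> \<partial>M) \<le> \<epsilon> * (\<integral>\<omega>. a2bcd_error p f x y v 0 \<omega> \<partial>M)"
      by (intro iterations_suffice) auto
  qed (rule K_A2BCD_asymptotics)
qed

end
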